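(* Let $C(A)$ be a bimodular cone, i.e. $A\in\mathbb{Z}^{m\times n}$ with $m\ge n$, $\operatorname{rank}(A)=n$ and $\Delta(A)=2$, and let $h$ be a non-trivial Hilbert basis element of $C(A)$ with respect to $\mathbb{Z}^n$. Then there exist two distinct normalized generators $r^i,r^j\in R(A)$, $i\ne j$, with $$h=\tfrac12 r^i+\tfrac12 r^j.$$
   Context: Notation: $[m]=\{1,\dots,m\}$; $A_{I,\cdot}$ is the submatrix of $A$ with rows indexed by $I$, and $A_{I,J}$ the submatrix with rows in $I$ and columns in $J$. $\Delta(A)$ is the maximum absolute value of an $n\times n$ minor of $A$. For an integer matrix $M$ with at least as many rows as columns, say $q$ columns, $\gcd(M)$ is the gcd of all $q\times q$ minors of $M$, and $\gcd(M^T):=\gcd(M)$; so for an $(n-1)\times n$ matrix it is the gcd of its $(n-1)\times(n-1)$ minors. For $A\in\mathbb{Z}^{m\times n}$ with $m\ge n$ and full column rank, $C(A):=\{x\in\mathbb{R}^n: Ax\ge 0\}$, a rational pointed cone. An extreme ray is a 1-dimensional face. Hilbert basis: a nonzero $h\in C(A)\cap\mathbb{Z}^n$ is a Hilbert basis element of $C(A)$ with respect to $\mathbb{Z}^n$ if for all $z^1,z^2\in C(A)\cap\mathbb{Z}^n$ with $h=z^1+z^2$ we have $z^1=0$ or $z^2=0$. It is trivial if it lies on an extreme ray of $C(A)$, and non-trivial otherwise. Normalized generators: for each extreme ray of $C(A)$, consider all $I\subseteq[m]$ with $|I|=n-1$, $\operatorname{rank}(A_{I,\cdot})=n-1$ and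 $A_{I,\cdot}r=0$ for $r$ on the ray; choose such an $I$ with $\gcd(A_{I,\cdot})$ maximal. The normalized generator of the ray is the vector $r$ on the ray with $r_i=(-1)^i\det A_{I,[n]\setminus\{i\}}$ for $i=1,\dots,n$, up to a global sign chosen so that $r\in C(A)$ (equivalently, $\gcd(A_{I,\cdot})$ times the primitive integer vector on the ray). $R(A)$ is the set of normalized generators. *)

theory Defs
  imports
    Complex_Main
    "Jordan_Normal_Form.Determinant"
    "Jordan_Normal_Form.DL_Rank"
    "Jordan_Normal_Form.DL_Submatrix"
begin

text \<open>Rows and columns of matrices are numbered from 0, so \<open>[m]\<close> becomes \<open>{0..<m}\<close>, and
  a matrix in \<open>carrier_mat m n\<close> has \<open>m\<close> rows and \<open>n\<close> columns. Cones and lattice points are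
  real vectors; the matrices that describe cones are integral.\<close>

definition minors :: "nat \<Rightarrow> int mat \<Rightarrow> int set" where
  "minors k M = {det (submatrix M I J) | I J.
     I \<subseteq> {0..<dim_row M} \<and> J \<subseteq> {0..<dim_col M} \<and> card I = k \<and> card J = k}"

text \<open>\<open>max_minor A\<close> is \<open>\<Delta>(A)\<close>; the set of minors is nonempty if \<open>dim_col A \<le> dim_row A\<close>.\<close>

definition max_minor :: "int mat \<Rightarrow> int" where
  "max_minor A = Max (abs ` minors (dim_col A) A)"

text \<open>The minors of maximal size are the same for \<open>M\<close> and its transpose (the determinant is
  invariant under transposition), so taking the minimum of the dimensions covers both
  \<open>gcd(M)\<close> for tall matrices and \<open>gcd(M\<^sup>T) := gcd(M)\<close>.\<close>

definition gcd_mat :: "int mat \<Rightarrow> int" where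
  "gcd_mat M = Gcd (minors (min (dim_row M) (dim_col M)) M)"

definition rank_mat :: "int mat \<Rightarrow> nat" where
  "rank_mat M = vec_space.rank (dim_row M) (map_mat real_of_int M)"

definition cone_of :: "int mat \<Rightarrow> real vec set" where
  "cone_of A = {x \<in> carrier_vec (dim_col A). 0\<^sub>v (dim_row A) \<le> map_mat real_of_int A *\<^sub>v x}"

definition int_points :: "nat \<Rightarrow> real vec set" where
  "int_points n = {x \<in> carrier_vec n. \<forall>i<n. x $ i \<in> \<int>}"

text \<open>Faces of a polyhedron \<open>P \<subseteq> \<real>\<^sup>n\<close>: the sets cut out by an inequality valid on \<open>P\<close>, including
  \<open>P\<close> itself (for \<open>c = 0\<close>, \<open>d = 0\<close>).\<close>

definition is_face :: "nat \<Rightarrow> real vec set \<Rightarrow> real vec set \<Rightarrow> bool" where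
  "is_face n F P \<longleftrightarrow> (\<exists>c \<in> carrier_vec n. \<exists>d.
     (\<forall>x \<in> P. d \<le> c \<bullet> x) \<and> F = {x \<in> P. c \<bullet> x = d})"

text \<open>The dimension of a nonempty subset of \<open>\<real>\<^sup>n\<close>, i.e. the dimension of the linear space parallel
  to its affine hull. (The empty set gets 0.)\<close>

definition set_dim :: "nat \<Rightarrow> real vec set \<Rightarrow> nat" where
  "set_dim n S = vectorspace.dim class_ring
     (LinearCombinations.module.span_vs class_ring (module_vec TYPE(real) n)
       {x - y | x y. x \<in> S \<and> y \<in> S})"

definition extreme_rays :: "int mat \<Rightarrow> real vec set set" where
  "extreme_rays A =
     {F. is_face (dim_col A) F (cone_of A) \<and> set_dim (dim_col A) F = 1}"

definition hilbert_basis :: "int mat \<Rightarrow> real vec set" where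
  "hilbert_basis A = {h \<in> cone_of A \<inter> int_points (dim_col A).
     h \<noteq> 0\<^sub>v (dim_col A) \<and>
     (\<forall>z1 \<in> cone_of A \<inter> int_points (dim_col A).
      \<forall>z2 \<in> cone_of A \<inter> int_points (dim_col A).
        h = z1 + z2 \<longrightarrow> z1 = 0\<^sub>v (dim_col A) \<or> z2 = 0\<^sub>v (dim_col A))}"

definition nontrivial_hilbert_basis :: "int mat \<Rightarrow> real vec set" where
  "nontrivial_hilbert_basis A = {h \<in> hilbert_basis A. \<forall>F \<in> extreme_rays A. h \<notin> F}"

abbreviation row_submatrix :: "int mat \<Rightarrow> nat set \<Rightarrow> int mat" where
  "row_submatrix A I \<equiv> submatrix A I {0..<dim_col A}"

definition ray_row_sets :: "int mat \<Rightarrow> real vec set \<Rightarrow> nat set set" where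
  "ray_row_sets A F = {I. I \<subseteq> {0..<dim_row A} \<and> card I = dim_col A - 1 \<and>
     rank_mat (row_submatrix A I) = dim_col A - 1 \<and>
     (\<forall>r \<in> F. map_mat real_of_int (row_submatrix A I) *\<^sub>v r = 0\<^sub>v (dim_col A - 1))}"

text \<open>The exponent is \<open>i + 1\<close> because coordinate \<open>i\<close> here is coordinate \<open>i + 1\<close> in 1-based
  numbering.\<close>

definition minor_vec :: "int mat \<Rightarrow> nat set \<Rightarrow> real vec" where
  "minor_vec A I = vec (dim_col A) (\<lambda>i.
     real_of_int ((- 1) ^ (i + 1) * det (submatrix A I ({0..<dim_col A} - {i}))))"

text \<open>The row set \<open>I\<close> of maximal gcd need not be unique, but the resulting vector on the ray is:
  it is the primitive integer vector of the ray times the maximal gcd. Hence quantifying over all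
  maximizers \<open>I\<close> still yields exactly one generator per extreme ray.\<close>

definition normalized_generators :: "int mat \<Rightarrow> real vec set" where
  "normalized_generators A = {r. \<exists>F \<in> extreme_rays A. \<exists>I \<in> ray_row_sets A F.
     (\<forall>K \<in> ray_row_sets A F. gcd_mat (row_submatrix A K) \<le> gcd_mat (row_submatrix A I)) \<and>
     (r = minor_vec A I \<or> r = - minor_vec A I) \<and> r \<in> F}"

definition bimodular :: "int mat \<Rightarrow> bool" where
  "bimodular A \<longleftrightarrow>
     dim_col A \<le> dim_row A \<and> rank_mat A = dim_col A \<and> max_minor A = 2"

end

theory Submission
  imports Defs "Jordan_Normal_Form.DL_Rank_Submatrix"
begin

text \<open>
  Write \<open>C\<close> for the cone and \<open>a\<^sub>l\<close> for the rows of \<open>A\<close>. The vector \<open>p\<close> of signed maximal minors of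
  \<open>n - 1\<close> rows is orthogonal to these rows, and by Laplace expansion \<open>a\<^sub>l \<bullet> p\<close> is, up to sign, the
  \<open>n \<times> n\<close> minor obtained by adding row \<open>l\<close>. If \<open>A\<close> is bimodular, then \<open>\<bar>a\<^sub>l \<bullet> p\<bar> \<le> 2\<close> for every
  row; this bound and parity drive the proof.

  Let \<open>h\<close> be an indecomposable lattice point on no extreme ray, and let \<open>p\<close> generate an
  extreme ray of the minimal face of \<open>C\<close> containing \<open>h\<close>. As \<open>h - p\<close> cannot lie in \<open>C\<close>, some row has
  \<open>a\<^sub>k \<bullet> p > a\<^sub>k \<bullet> h \<ge> 1\<close>, hence \<open>a\<^sub>k \<bullet> p = 2\<close> and \<open>a\<^sub>k \<bullet> h = 1\<close>; the same argument applied to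
  integral fractions of \<open>p\<close> shows that \<open>p\<close> is primitive (\<open>generator_below_indecomposable\<close>). So
  \<open>p/2\<close> is a nonintegral vertex of the polytope \<open>P = C \<inter> (h - C)\<close>, and the only lattice points of
  \<open>P\<close> are \<open>0\<close> and \<open>h\<close>.

  From \<open>p/2\<close> one walks along an edge of \<open>P\<close> to a lattice point. Since \<open>a\<^sub>l \<bullet> p\<close> is even for all rows
  that are tight at \<open>p/2\<close>, all \<open>n \<times> n\<close> minors formed by these rows are even, and the signed minor
  vectors \<open>d\<close> that span edges at \<open>p/2\<close> satisfy \<open>a\<^sub>l \<bullet> d \<in> {0, 2}\<close> on the tight rows, up to
  orientation. Starting from
  \<open>2h - p\<close>, which points into \<open>P\<close> and is not in \<open>2\<int>\<^sup>n\<close>, and subtracting edge vectors in \<open>2\<int>\<^sup>n\<close> as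
  long as there are any, one finds an edge vector \<open>d \<notin> 2\<int>\<^sup>n\<close>. Modulo 2 the tight rows have the kernel
  \<open>{0, p}\<close>, so \<open>d \<equiv> p\<close> and \<open>(p + d)/2\<close> is integral. The bound \<open>\<bar>a\<^sub>l \<bullet> d\<bar> \<le> 2\<close> keeps this point in \<open>P\<close>,
  whence \<open>(p + d)/2 = h\<close>. Thus \<open>2h - p = d\<close> is a signed minor vector as well, and \<open>h\<close> is half the
  sum of two ray generators (\<open>indecomposable_is_half_sum\<close>).

  Both ray generators are primitive and attain the value 2 on some row. If \<open>p\<close> is one of them and \<open>K\<close> any set of \<open>n - 1\<close>
  rows orthogonal to \<open>p\<close>, Cramer's rule then bounds \<open>2 gcd(A\<^sub>K)\<close> by an \<open>n \<times> n\<close> minor, so that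
  \<open>gcd(A\<^sub>K) \<le> 1\<close> and the primitive vector is the normalized generator
  (\<open>primitive_facet_vector_is_normalized_generator\<close>).

  The existence of suitable ray generators rests on \<open>minor_ray_below\<close>, an elementary form of the
  statement that every face of a pointed cone contains an extreme ray.
\<close>

section \<open>Signed minors and Cramer's rule\<close>

lemma pick_initial_segment:
  assumes "i < n"
  shows "pick {0..<n} i = i"
proof -
  have "{a \<in> {0..<n}. a < i} = {0..<i}" using assms by auto
  thus ?thesis using pick_card_in_set[of i "{0..<n}"] assms by simp
qed

lemma pick_remove:
  assumes "j < n" "i < n - 1"
  shows "pick ({0..<n} - {j}) i = (if i < j then i else Suc i)"
proof -
  define k where "k = (if i < j then i else Suc i)"
  have "{a \<in> {0..<n} - {j}. a < k} = (if i < j then {0..<i} else {0..<Suc i} - {j})"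
    using assms by (auto simp: k_def)
  hence "card {a \<in> {0..<n} - {j}. a < k} = i" by (auto simp: card_Diff_subset)
  thus ?thesis using pick_card_in_set[of k "{0..<n} - {j}"] assms by (auto simp: k_def)
qed

lemma restricted_index_set: "I \<subseteq> {0..<m} \<Longrightarrow> {i. i < m \<and> i \<in> I} = I"
  by auto

lemma submatrix_of_subsets:
  assumes "A \<in> carrier_mat m n" "I \<subseteq> {0..<m}" "J \<subseteq> {0..<n}"
  shows "submatrix A I J \<in> carrier_mat (card I) (card J)"
    and "i < card I \<Longrightarrow> j < card J \<Longrightarrow> submatrix A I J $$ (i, j) = A $$ (pick I i, pick J j)"
proof -
  have I: "{i. i < dim_row A \<and> i \<in> I} = I" and J: "{j. j < dim_col A \<and> j \<in> J} = J"
    using assms by auto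
  show "submatrix A I J \<in> carrier_mat (card I) (card J)"
    by (rule carrier_matI) (simp_all only: dim_submatrix I J)
  show "submatrix A I J $$ (i, j) = A $$ (pick I i, pick J j)" if "i < card I" "j < card J"
    by (rule submatrix_index) (simp_all only: I J that)
qed

lemma pick_in_index_set:
  assumes "I \<subseteq> {0..<m}" "i < card I"
  shows "pick I i \<in> I" "pick I i < m"
  using pick_in_set[of i I] assms by (auto)

lemma index_is_pick:
  assumes "I \<subseteq> {0..<m}" "k \<in> I"
  shows "\<exists>i < card I. pick I i = k"
proof -
  have f: "finite I" using assms finite_subset by blast
  have "card {a\<in>I. a < k} < card I" using assms f by (intro psubset_card_mono) auto
  thus ?thesis using pick_card_in_set[OF assms(2)] by blast
qed

text \<open>The generalized cross product of the rows in \<open>I\<close>. It agrees with \<open>minor_vec\<close>, but it is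
  available over every commutative ring, so that Cramer's rule applies to integer and to real points
  alike.\<close>

definition signed_minors :: "'a :: comm_ring_1 mat \<Rightarrow> nat set \<Rightarrow> 'a vec" where
  "signed_minors A I = vec (dim_col A) (\<lambda>j.
     (- 1) ^ (j + 1) * det (submatrix A I ({0..<dim_col A} - {j})))"

text \<open>Placing the extra row \<open>b\<close> last, and not at its sorted position, makes the cofactors of \<open>b\<close>
  independent of \<open>b\<close>; it costs only the sign \<open>(- 1) ^ n\<close>.\<close>

definition bordered :: "'a mat \<Rightarrow> nat set \<Rightarrow> 'a vec \<Rightarrow> 'a mat" where
  "bordered A I b = mat (dim_col A) (dim_col A)
     (\<lambda>(i, j). if i < dim_col A - 1 then A $$ (pick I i, j) else b $ j)"

lemma signed_minors_carrier [simp]: "A \<in> carrier_mat m n \<Longrightarrow> signed_minors A I \<in> carrier_vec n"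
  by (auto simp: signed_minors_def)

lemma bordered_carrier [simp]: "A \<in> carrier_mat m n \<Longrightarrow> bordered A I b \<in> carrier_mat n n"
  by (auto simp: bordered_def)

context
  fixes A :: "'a :: comm_ring_1 mat" and m n :: nat and I :: "nat set"
  assumes A: "A \<in> carrier_mat m n" and I: "I \<subseteq> {0..<m}" and cI: "card I = n - 1" and n: "0 < n"
begin

lemma row_bordered:
  assumes "b \<in> carrier_vec n"
  shows "i < n - 1 \<Longrightarrow> row (bordered A I b) i = row A (pick I i)"
    and "row (bordered A I b) (n - 1) = b"
  using assms A n pick_in_index_set[OF I] cI by (auto simp: bordered_def)

lemma cofactor_bordered:
  assumes j: "j < n"
  shows "cofactor (bordered A I b) (n - 1) j = (- 1) ^ n * signed_minors A I $ j"
proof -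
  have sub: "mat_delete (bordered A I b) (n - 1) j = submatrix A I ({0..<n} - {j})"
  proof (rule eq_matI)
    have c: "{i. i < m \<and> i \<in> I} = I" using restricted_index_set[OF I] .
    have c': "{i. i < n \<and> i \<in> {0..<n} - {j}} = {0..<n} - {j}" by auto
    have cc: "card ({0..<n} - {j}) = n - 1" using j by simp
    show "dim_row (mat_delete (bordered A I b) (n - 1) j) = dim_row (submatrix A I ({0..<n} - {j}))"
      "dim_col (mat_delete (bordered A I b) (n - 1) j) = dim_col (submatrix A I ({0..<n} - {j}))"
      using A c c' cc cI by (auto simp: mat_delete_def dim_submatrix bordered_def)
    fix i k assume "i < dim_row (submatrix A I ({0..<n} - {j}))"
      "k < dim_col (submatrix A I ({0..<n} - {j}))"
    hence ik: "i < n - 1" "k < n - 1" using A c c' cc cI by (auto simp: dim_submatrix)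
    show "mat_delete (bordered A I b) (n - 1) j $$ (i, k) = submatrix A I ({0..<n} - {j}) $$ (i, k)"
      using A c c' cc cI ik j
      by (subst submatrix_index) (auto simp: mat_delete_def bordered_def pick_remove)
  qed
  have "(- 1 :: 'a) ^ (n - 1 + j) = (- 1) ^ n * (- 1) ^ (j + 1)"
    using n by (cases n) (auto simp: power_add)
  thus ?thesis using A j unfolding cofactor_def sub by (simp add: signed_minors_def mult.assoc)
qed

lemma det_bordered:
  assumes b: "b \<in> carrier_vec n"
  shows "det (bordered A I b) = (- 1) ^ n * (b \<bullet> signed_minors A I)"
proof -
  have "det (bordered A I b) = (\<Sum>j<n. bordered A I b $$ (n - 1, j) * cofactor (bordered A I b) (n - 1) j)"
    using n by (intro laplace_expansion_row[OF bordered_carrier[OF A]]) simp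
  also have "\<dots> = (\<Sum>j<n. (- 1) ^ n * (b $ j * signed_minors A I $ j))"
  proof (intro sum.cong refl)
    fix j assume "j \<in> {..<n}"
    hence j: "j < n" by simp
    have "bordered A I b $$ (n - 1, j) = b $ j" using A j by (simp add: bordered_def)
    thus "bordered A I b $$ (n - 1, j) * cofactor (bordered A I b) (n - 1) j
      = (- 1) ^ n * (b $ j * signed_minors A I $ j)"
      unfolding cofactor_bordered[OF j] by (simp add: mult_ac)
  qed
  also have "\<dots> = (- 1) ^ n * (b \<bullet> signed_minors A I)"
    using A by (simp add: scalar_prod_def sum_distrib_left lessThan_atLeast0 signed_minors_def)
  finally show ?thesis .
qed

lemma signed_minors_orthogonal:
  assumes "i \<in> I"
  shows "row A i \<bullet> signed_minors A I = 0"
proof -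
  obtain k where k: "k < n - 1" "pick I k = i" using index_is_pick[OF I assms] cI by auto
  have b: "row A i \<in> carrier_vec n" using A assms I by auto
  have "det (bordered A I (row A i)) = 0"
    using det_identical_rows[OF bordered_carrier[OF A], of k "n - 1"] row_bordered[OF b] k n by simp
  hence "(- 1) ^ n * ((- 1) ^ n * (row A i \<bullet> signed_minors A I)) = 0"
    unfolding det_bordered[OF b] by simp
  thus ?thesis unfolding mult.assoc[symmetric] power_add[symmetric]
    by (simp add: mult_2[symmetric])
qed

lemma bordered_mult:
  assumes b: "b \<in> carrier_vec n" and x: "x \<in> carrier_vec n" and i: "i < n"
  shows "(bordered A I b *\<^sub>v x) $ i = (if i < n - 1 then row A (pick I i) \<bullet> x else b \<bullet> x)"
proof -
  have "i = n - 1" if "\<not> i < n - 1" using that i by simp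
  thus ?thesis using row_bordered[OF b] A i by (auto simp: bordered_def)
qed

end

lemma det_mult_vec_index:
  fixes B :: "'a :: comm_ring_1 mat"
  assumes B: "B \<in> carrier_mat n n" and x: "x \<in> carrier_vec n" and j: "j < n"
  shows "det B * x $ j = (\<Sum>i<n. cofactor B i j * (B *\<^sub>v x) $ i)"
proof -
  have "adj_mat B *\<^sub>v (B *\<^sub>v x) = (det B \<cdot>\<^sub>m 1\<^sub>m n) *\<^sub>v x"
    using adj_mat[OF B] B x by (metis assoc_mult_mat_vec)
  hence "(adj_mat B *\<^sub>v (B *\<^sub>v x)) $ j = det B * x $ j"
    using x j by (simp add: mult_mat_vec_def scalar_prod_def sum.delta' if_distrib[of "\<lambda>t. _ * t * _"] cong: if_cong)
  moreover have "(adj_mat B *\<^sub>v (B *\<^sub>v x)) $ j = (\<Sum>i<n. cofactor B i j * (B *\<^sub>v x) $ i)"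
    using B j by (auto simp: adj_mat_def scalar_prod_def lessThan_atLeast0 intro!: sum.cong)
  ultimately show ?thesis by simp
qed

text \<open>Cramer's rule for \<open>x\<close> in the kernel of the rows in \<open>I\<close>, in a division-free form. It shows that the
  kernel of these rows is the line through the signed minors as soon as one bordered determinant
  does not vanish.\<close>

lemma cramer_bordered:
  fixes A :: "'a :: comm_ring_1 mat"
  assumes A: "A \<in> carrier_mat m n" and I: "I \<subseteq> {0..<m}" and cI: "card I = n - 1" and n: "0 < n"
    and b: "b \<in> carrier_vec n" and x: "x \<in> carrier_vec n"
    and ker: "\<And>i. i \<in> I \<Longrightarrow> row A i \<bullet> x = 0" and j: "j < n"
  shows "det (bordered A I b) * x $ j = (- 1) ^ n * (b \<bullet> x) * signed_minors A I $ j"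
proof -
  have "det (bordered A I b) * x $ j
      = (\<Sum>i<n. cofactor (bordered A I b) i j * (bordered A I b *\<^sub>v x) $ i)"
    using det_mult_vec_index[OF bordered_carrier[OF A] x j] .
  also have "\<dots> = (\<Sum>i<n. if i = n - 1 then cofactor (bordered A I b) i j * (b \<bullet> x) else 0)"
  proof (intro sum.cong refl)
    fix i assume i: "i \<in> {..<n}"
    have "row A (pick I i) \<bullet> x = 0" if "i < n - 1"
      using pick_in_index_set[OF I] cI ker that by simp
    thus "cofactor (bordered A I b) i j * (bordered A I b *\<^sub>v x) $ i
      = (if i = n - 1 then cofactor (bordered A I b) i j * (b \<bullet> x) else 0)"
      using bordered_mult[OF A I cI n b x, of i] i by auto
  qed
  also have "\<dots> = cofactor (bordered A I b) (n - 1) j * (b \<bullet> x)" using n by simp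
  finally show ?thesis using cofactor_bordered[OF A I cI n j, of b] by (simp add: mult_ac)
qed

text \<open>The adjugate argument modulo \<open>d\<close>: a vector in the kernel modulo \<open>d\<close> is killed by the determinant.
  With \<open>d = 2\<close> it yields both the parity of minors and the kernel modulo 2.\<close>

lemma dvd_det_bordered:
  fixes A :: "'a :: comm_ring_1 mat"
  assumes A: "A \<in> carrier_mat m n" and I: "I \<subseteq> {0..<m}" and cI: "card I = n - 1" and n: "0 < n"
    and b: "b \<in> carrier_vec n" and x: "x \<in> carrier_vec n"
    and rows: "\<And>i. i \<in> I \<Longrightarrow> d dvd row A i \<bullet> x" and last: "d dvd b \<bullet> x" and j: "j < n"
  shows "d dvd det (bordered A I b) * x $ j"
proof -
  have "d dvd (bordered A I b *\<^sub>v x) $ i" if "i < n" for i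
    using bordered_mult[OF A I cI n b x that] pick_in_index_set[OF I] cI rows last by auto
  thus ?thesis unfolding det_mult_vec_index[OF bordered_carrier[OF A] x j]
    by (intro dvd_sum) auto
qed

lemma finite_minors: "finite (minors k M)"
proof -
  have "minors k M \<subseteq> (\<lambda>(I, J). det (submatrix M I J)) ` (Pow {0..<dim_row M} \<times> Pow {0..<dim_col M})"
    by (auto simp: minors_def)
  thus ?thesis by (rule finite_subset) simp
qed

lemma max_minor_ge:
  assumes "d \<in> minors (dim_col A) A"
  shows "\<bar>d\<bar> \<le> max_minor A"
  unfolding max_minor_def using assms finite_minors by (intro Max_ge) auto

text \<open>Repeated rows give determinant 0, and a reordering of the rows only changes the sign, so every
  list of \<open>n\<close> row indices is controlled by the minors of the increasing ones.\<close>

lemma det_selected_rows_le: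
  fixes A :: "int mat"
  assumes A: "A \<in> carrier_mat m n" and f: "\<And>i. i < n \<Longrightarrow> f i < m" and ge: "0 \<le> max_minor A"
  shows "\<bar>det (mat n n (\<lambda>(i, j). A $$ (f i, j)))\<bar> \<le> max_minor A"
proof (cases "inj_on f {0..<n}")
  case False
  then obtain i j where ij: "i < n" "j < n" "i \<noteq> j" "f i = f j" by (auto simp: inj_on_def)
  have "det (mat n n (\<lambda>(i, j). A $$ (f i, j))) = 0"
    using ij by (intro det_identical_rows[of _ n i j]) (auto simp: row_def)
  thus ?thesis using ge by simp
next
  case True
  define K where "K = f ` {0..<n}"
  have K: "K \<subseteq> {0..<m}" "card K = n" "finite K"
    using f True by (auto simp: K_def card_image)
  define S where "S = submatrix A K {0..<n}"
  have S: "S \<in> carrier_mat n n"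
    using A K restricted_index_set[OF K(1)] by (auto simp: S_def dim_submatrix)
  have Sij: "S $$ (i, j) = A $$ (pick K i, j)" if "i < n" "j < n" for i j
    using A K restricted_index_set[OF K(1)] that
    by (subst S_def, subst submatrix_index) (auto simp: pick_initial_segment)
  define p where "p i = (if i < n then card {a \<in> K. a < f i} else i)" for i
  have pn: "p i < n" if "i < n" for i
  proof -
    have "card {a \<in> K. a < f i} < card K"
      using K that by (intro psubset_card_mono) (auto simp: K_def)
    thus ?thesis using that K by (simp add: p_def)
  qed
  have pick: "pick K (p i) = f i" if "i < n" for i
    using pick_card_in_set[of "f i" K] that by (simp add: p_def K_def)
  have inj: "inj_on p {0..<n}"
    using True pick by (metis atLeastLessThan_iff inj_onD inj_onI)
  have "p permutes {0..<n}"
  proof (rule bij_imp_permutes)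
    show "bij_betw p {0..<n} {0..<n}"
      using inj pn by (intro bij_betw_imageI endo_inj_surj) auto
  qed (auto simp: p_def)
  note perm = det_permute_rows[OF S this]
  have "mat n n (\<lambda>(i, j). S $$ (p i, j)) = mat n n (\<lambda>(i, j). A $$ (f i, j))"
    using Sij pn pick by (intro cong_mat) auto
  hence "\<bar>det (mat n n (\<lambda>(i, j). A $$ (f i, j)))\<bar> = \<bar>det S\<bar>"
    using perm by (simp add: abs_mult sign_def)
  also have "\<dots> \<le> max_minor A"
  proof (rule max_minor_ge)
    have "dim_row A = m" "dim_col A = n" "card {0..<n} = n" using A by auto
    thus "det S \<in> minors (dim_col A) A" using K unfolding minors_def S_def by blast
  qed
  finally show ?thesis .
qed

lemma det_bordered_le:
  fixes A :: "int mat"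
  assumes A: "A \<in> carrier_mat m n" and I: "I \<subseteq> {0..<m}" and cI: "card I = n - 1"
    and l: "l < m" and ge: "0 \<le> max_minor A"
  shows "\<bar>det (bordered A I (row A l))\<bar> \<le> max_minor A"
proof -
  have "bordered A I (row A l)
      = mat n n (\<lambda>(i, j). A $$ (if i < n - 1 then pick I i else l, j))"
    using A l unfolding bordered_def by (intro cong_mat) auto
  thus ?thesis
    using det_selected_rows_le[OF A, of "\<lambda>i. if i < n - 1 then pick I i else l"]
      pick_in_index_set(2)[OF I] cI l ge by simp
qed

section \<open>Extreme rays in the faces of a pointed cone\<close>

definition trivial_kernel :: "int mat \<Rightarrow> nat set \<Rightarrow> bool" where
  "trivial_kernel A L \<longleftrightarrow>
     (\<forall>x \<in> carrier_vec (dim_col A). (\<forall>l \<in> L. row A l \<bullet> x = 0) \<longrightarrow> x = 0\<^sub>v (dim_col A))"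

lemma row_lincomb:
  fixes A :: "'a :: comm_ring_1 mat"
  assumes "A \<in> carrier_mat m n" "l < m" "x \<in> carrier_vec n" "y \<in> carrier_vec n"
  shows "row A l \<bullet> (a \<cdot>\<^sub>v x + b \<cdot>\<^sub>v y) = a * (row A l \<bullet> x) + b * (row A l \<bullet> y)"
proof -
  have "row A l \<in> carrier_vec n" using assms by auto
  thus ?thesis using assms(3,4) by (simp add: scalar_prod_add_distrib[of _ n])
qed

lemma few_rows_have_kernel:
  fixes A :: "int mat"
  assumes A: "A \<in> carrier_mat m n" and S: "finite S" "S \<noteq> {}" "S \<subseteq> {0..<m}" and c: "card S < n"
  shows "\<not> trivial_kernel A S"
proof -
  obtain g where g: "bij_betw g {0..<card S} S" using ex_bij_betw_nat_finite[OF S(1)] by blast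
  have c0: "0 < card S" using S by (simp add: card_gt_0_iff)
  define f where "f i = (if i < card S then g i else g 0)" for i
  have fS: "f i \<in> S" for i using g c0 by (auto simp: f_def bij_betw_def)
  define B where "B = mat n n (\<lambda>(i, j). A $$ (f i, j))"
  have B: "B \<in> carrier_mat n n" by (simp add: B_def)
  have rowB: "row B i = row A (f i)" if "i < n" for i
    using A fS[of i] S(3) that by (intro eq_vecI) (auto simp: B_def)
  have "det B = 0"
  proof (rule det_identical_rows[OF B])
    show "card S \<noteq> 0" "card S < n" "0 < n" using c0 c by auto
    show "row B (card S) = row B 0" using rowB c c0 by (simp add: f_def)
  qed
  then obtain u where u: "u \<in> carrier_vec n" "u \<noteq> 0\<^sub>v n" "B *\<^sub>v u = 0\<^sub>v n"
    using det_0_iff_vec_prod_zero[OF B] by blast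
  have "row A l \<bullet> u = 0" if "l \<in> S" for l
  proof -
    have "l \<in> g ` {0..<card S}" using bij_betw_imp_surj_on[OF g] that by blast
    then obtain i where i: "i < card S" "l = g i" by auto
    have "i < n" using i c by simp
    have "row A l \<bullet> u = row B i \<bullet> u" using rowB[OF \<open>i < n\<close>] i by (simp add: f_def)
    also have "\<dots> = (B *\<^sub>v u) $ i" using B \<open>i < n\<close> by simp
    also have "\<dots> = 0" using u(3) \<open>i < n\<close> by simp
    finally show ?thesis .
  qed
  thus ?thesis using u A unfolding trivial_kernel_def by auto
qed

text \<open>As \<open>r\<close> is a common zero of the rows in \<open>I\<close>, any \<open>n\<close> of these rows are linearly dependent. A row with
  a nonzero coefficient in the dependency vanishes wherever the others vanish.\<close>

lemma dependent_row_exists: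
  fixes A :: "int mat"
  assumes A: "A \<in> carrier_mat m n" and I: "I \<subseteq> {0..<m}" "n \<le> card I"
    and r: "r \<in> carrier_vec n" "r \<noteq> 0\<^sub>v n" "\<And>i. i \<in> I \<Longrightarrow> row A i \<bullet> r = 0"
  shows "\<exists>i \<in> I. \<forall>u \<in> carrier_vec n.
    (\<forall>j \<in> I - {i}. row A j \<bullet> u = 0) \<longrightarrow> row A i \<bullet> u = 0"
proof -
  have fin: "finite I" using I(1) finite_subset by blast
  obtain J where J: "J \<subseteq> I" "card J = n" using I(2) obtain_subset_with_card_n by metis
  have finJ: "finite J" using J fin finite_subset by blast
  obtain g where "bij_betw g {0..<card J} J" using ex_bij_betw_nat_finite[OF finJ] by blast
  hence g: "bij_betw g {0..<n} J" using J by simp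
  have gJ: "g i \<in> J" if "i < n" for i using g that by (auto simp: bij_betw_def)
  define B where "B = mat n n (\<lambda>(i, j). A $$ (g i, j))"
  have B: "B \<in> carrier_mat n n" by (simp add: B_def)
  have rowB: "row B i = row A (g i)" if "i < n" for i
    using A gJ[OF that] J I(1) that by (intro eq_vecI) (auto simp: B_def)
  have Bu: "(B *\<^sub>v u) $ i = row A (g i) \<bullet> u" if "i < n" for i u
    using B rowB that by simp
  have "row A (g i) \<bullet> r = 0" if "i < n" for i using r(3) gJ[OF that] J(1) by blast
  hence "B *\<^sub>v r = 0\<^sub>v n" using B rowB by (intro eq_vecI) auto
  hence "det B = 0" using det_0_iff_vec_prod_zero[OF B] r by blast
  hence "det B\<^sup>T = 0" using det_transpose[OF B] by simp
  then obtain c where c: "c \<in> carrier_vec n" "c \<noteq> 0\<^sub>v n" "B\<^sup>T *\<^sub>v c = 0\<^sub>v n"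
    using det_0_iff_vec_prod_zero[of "B\<^sup>T" n] B by auto
  then obtain k where k: "k < n" "c $ k \<noteq> 0" by (metis eq_vecI carrier_vecD index_zero_vec)
  have "row A (g k) \<bullet> u = 0"
    if u: "u \<in> carrier_vec n" and z: "\<forall>j \<in> I - {g k}. row A j \<bullet> u = 0" for u
  proof -
    have other: "(B *\<^sub>v u) $ i = 0" if "i < n" "i \<noteq> k" for i
    proof -
      have "g i \<noteq> g k" using g that k by (auto simp: bij_betw_def inj_on_def)
      moreover have "g i \<in> I" using gJ that(1) J(1) by blast
      ultimately show ?thesis using Bu z that(1) by simp
    qed
    have "0 = (B\<^sup>T *\<^sub>v c) \<bullet> u" using c(3) u by simp
    also have "\<dots> = c \<bullet> (B *\<^sub>v u)" using transpose_vec_mult_scalar[OF B u c(1)] .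
    also have "\<dots> = (\<Sum>i<n. c $ i * (B *\<^sub>v u) $ i)"
      using B by (simp add: scalar_prod_def lessThan_atLeast0)
    also have "\<dots> = (\<Sum>i<n. if i = k then c $ k * (B *\<^sub>v u) $ k else 0)"
      using other by (intro sum.cong) auto
    also have "\<dots> = c $ k * (row A (g k) \<bullet> u)" using k Bu by simp
    finally show ?thesis using k by simp
  qed
  thus ?thesis using gJ[OF k(1)] J(1) by blast
qed

text \<open>The set \<open>I\<close> is a smallest subset of \<open>Z\<close> that, together with \<open>q\<close>, has trivial kernel: fewer than
  \<open>n - 1\<close> rows in \<open>I\<close> leave a kernel, and from \<open>n\<close> or more rows a dependent one could be dropped.\<close>

lemma facet_rows_of_ray:
  assumes A: "A \<in> carrier_mat m n" and Z: "Z \<subseteq> {0..<m}" and q: "q < m"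
    and r: "r \<in> carrier_vec n" "\<And>i. i \<in> Z \<Longrightarrow> row A i \<bullet> r = 0" "row A q \<bullet> r \<noteq> 0"
    and ker: "trivial_kernel A (insert q Z)"
  shows "\<exists>I \<subseteq> Z. card I = n - 1 \<and> trivial_kernel A (insert q I)"
proof -
  have finZ: "finite Z" using Z finite_subset by blast
  have r0: "r \<noteq> 0\<^sub>v n" using r(3) A q by auto
  hence n: "0 < n" using r(1) by (cases n) auto
  define P where "P I \<longleftrightarrow> I \<subseteq> Z \<and> trivial_kernel A (insert q I)" for I
  define I where "I = arg_min card P"
  have I: "P I" "\<And>J. P J \<Longrightarrow> card I \<le> card J"
    using arg_min_nat_lemma[of P Z card] ker by (auto simp: I_def P_def)
  have IZ: "I \<subseteq> Z" using I by (simp add: P_def)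
  have finI: "finite I" using IZ finZ finite_subset by blast
  have "\<not> card (insert q I) < n"
    using few_rows_have_kernel[OF A, of "insert q I"] I(1) finI IZ Z q by (auto simp: P_def)
  moreover have "card (insert q I) \<le> card I + 1" using card_insert_le_m1[of "card I + 1" I q]
    by (simp add: card_insert_if finI)
  ultimately have ge: "n - 1 \<le> card I" by simp
  have "\<not> n \<le> card I"
  proof
    assume "n \<le> card I"
    then obtain i where i: "i \<in> I" and dep: "\<forall>u \<in> carrier_vec n.
        (\<forall>j \<in> I - {i}. row A j \<bullet> u = 0) \<longrightarrow> row A i \<bullet> u = 0"
      using dependent_row_exists[OF A, of I r] IZ Z r r0 by blast
    have "P (I - {i})" using I(1) dep A unfolding P_def trivial_kernel_def by blast
    hence "card I \<le> card (I - {i})" by (rule I(2))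
    thus False using card_Diff1_less[OF finI i] by simp
  qed
  hence "card I = n - 1" using ge by simp
  thus ?thesis using I(1) P_def by blast
qed

text \<open>Among the nonzero points of the cone that are tight wherever \<open>y\<close> is, choose \<open>r\<close> with as many tight
  rows as possible. A direction orthogonal to the tight rows and to a further row \<open>q\<close> would allow
  moving \<open>r\<close> until another row becomes tight, while the value at \<open>q\<close> keeps the point nonzero. Thus
  the tight rows and \<open>q\<close> have trivial kernel.\<close>

lemma ray_below:
  assumes A: "A \<in> carrier_mat m n" and L: "L \<subseteq> {0..<m}" and ker: "trivial_kernel A L"
    and y: "y \<in> carrier_vec n" "y \<noteq> 0\<^sub>v n" "\<And>l. l \<in> L \<Longrightarrow> 0 \<le> row A l \<bullet> y"
  shows "\<exists>r I q. r \<in> carrier_vec n \<and> (\<forall>l \<in> L. 0 \<le> row A l \<bullet> r) \<and>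
    (\<forall>l \<in> L. row A l \<bullet> y = 0 \<longrightarrow> row A l \<bullet> r = 0) \<and>
    I \<subseteq> L \<and> card I = n - 1 \<and> (\<forall>i \<in> I. row A i \<bullet> r = 0) \<and>
    q \<in> L \<and> 0 < row A q \<bullet> r \<and> trivial_kernel A (insert q I)"
proof -
  have finL: "finite L" using L finite_subset by blast
  define tight where "tight x = {l \<in> L. row A l \<bullet> x = 0}" for x
  define P where "P x \<longleftrightarrow> x \<in> carrier_vec n \<and> x \<noteq> 0\<^sub>v n \<and> (\<forall>l \<in> L. 0 \<le> row A l \<bullet> x) \<and>
    tight y \<subseteq> tight x" for x
  have "P y" using y by (auto simp: P_def)
  moreover have "\<forall>x. P x \<longrightarrow> card (tight x) < Suc (card L)"
    using finL by (auto simp: tight_def less_Suc_eq_le intro!: card_mono)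
  ultimately have "\<exists>x. P x \<and> (\<forall>x'. P x' \<longrightarrow> card (tight x') \<le> card (tight x))"
    by (rule ex_has_greatest_nat)
  then obtain r where r: "P r" "\<And>x. P x \<Longrightarrow> card (tight x) \<le> card (tight r)" by blast
  have rc: "r \<in> carrier_vec n" and rpos: "\<And>l. l \<in> L \<Longrightarrow> 0 \<le> row A l \<bullet> r"
    using r(1) by (auto simp: P_def)
  obtain q where q: "q \<in> L" "row A q \<bullet> r \<noteq> 0"
  proof -
    have "\<not> (\<forall>l \<in> L. row A l \<bullet> r = 0)"
      using ker r(1) carrier_matD(2)[OF A] unfolding trivial_kernel_def P_def by blast
    thus ?thesis using that by blast
  qed
  have qpos: "0 < row A q \<bullet> r" using rpos[OF q(1)] q(2) by simp
  have Lm: "l < m" if "l \<in> L" for l using L that by auto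
  have "trivial_kernel A (insert q (tight r))"
  proof (rule ccontr)
    assume "\<not> ?thesis"
    then obtain v where v: "v \<in> carrier_vec n" "v \<noteq> 0\<^sub>v n" "row A q \<bullet> v = 0"
      "\<And>l. l \<in> tight r \<Longrightarrow> row A l \<bullet> v = 0"
      using A unfolding trivial_kernel_def by auto
    then obtain l0 where l0: "l0 \<in> L" "row A l0 \<bullet> v \<noteq> 0"
      using ker A unfolding trivial_kernel_def by auto
    define u where "u = (if row A l0 \<bullet> v < 0 then v else (- 1) \<cdot>\<^sub>v v)"
    have ruv: "row A l \<bullet> u = (if row A l0 \<bullet> v < 0 then 1 else - 1) * (row A l \<bullet> v)" if "l \<in> L" for l
      using Lm[OF that] A v(1) by (simp add: u_def)
    have u: "u \<in> carrier_vec n" "row A q \<bullet> u = 0" "row A l0 \<bullet> u < 0"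
      "\<And>l. l \<in> tight r \<Longrightarrow> row A l \<bullet> u = 0"
      using v l0 ruv q by (auto simp: u_def tight_def)
    define S where "S = {l \<in> L. row A l \<bullet> u < 0}"
    define t where "t l = real_of_int (row A l \<bullet> r) / real_of_int (- (row A l \<bullet> u))" for l
    have S: "finite S" "S \<noteq> {}" using finL l0 u by (auto simp: S_def)
    obtain k where k: "k \<in> S" "\<And>l. l \<in> S \<Longrightarrow> t k \<le> t l"
    proof -
      have "Min (t ` S) \<in> t ` S" using S by (intro Min_in) auto
      then obtain k where "k \<in> S" "t k = Min (t ` S)" by auto
      thus ?thesis using that S by (metis Min_le finite_imageI imageI)
    qed
    have kL: "k \<in> L" and ku: "row A k \<bullet> u < 0" using k by (auto simp: S_def)
    have kr: "0 < row A k \<bullet> r"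
      using rpos[OF kL] u(4)[of k] ku kL by (force simp: tight_def)
    (* The point r + t k * u, at which the first row becomes tight, scaled by the denominator of
       t k so that it is again integral. *)
    define w where "w = (- (row A k \<bullet> u)) \<cdot>\<^sub>v r + (row A k \<bullet> r) \<cdot>\<^sub>v u"
    have w: "row A l \<bullet> w = - (row A k \<bullet> u) * (row A l \<bullet> r) + (row A k \<bullet> r) * (row A l \<bullet> u)"
      if "l \<in> L" for l
      unfolding w_def using row_lincomb[OF A Lm[OF that] rc u(1)] .
    have wc: "w \<in> carrier_vec n" using rc u(1) by (simp add: w_def)
    have wpos: "0 \<le> row A l \<bullet> w" if l: "l \<in> L" for l
    proof (cases "l \<in> S")
      case True
      hence lu: "row A l \<bullet> u < 0" by (simp add: S_def)
      have "real_of_int (row A k \<bullet> r) * real_of_int (- (row A l \<bullet> u))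
          \<le> real_of_int (row A l \<bullet> r) * real_of_int (- (row A k \<bullet> u))"
        using k(2)[OF True] lu ku by (simp add: t_def divide_simps split: if_splits)
      hence "(row A k \<bullet> r) * (- (row A l \<bullet> u)) \<le> (row A l \<bullet> r) * (- (row A k \<bullet> u))"
        by (metis of_int_le_iff of_int_mult)
      thus ?thesis using w[OF l] by (simp add: algebra_simps)
    next
      case False
      hence "0 \<le> row A l \<bullet> u" using l by (simp add: S_def)
      thus ?thesis unfolding w[OF l] using rpos[OF l] ku kr
        by (intro add_nonneg_nonneg mult_nonneg_nonneg) auto
    qed
    have "row A q \<bullet> w = - (row A k \<bullet> u) * (row A q \<bullet> r)" using w[OF q(1)] u(2) by simp
    hence wq: "row A q \<bullet> w \<noteq> 0" using ku q(2) by simp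
    hence "w \<noteq> 0\<^sub>v n" using A Lm[OF q(1)] by auto
    have tw: "insert k (tight r) \<subseteq> tight w"
    proof
      fix l assume l: "l \<in> insert k (tight r)"
      hence lL: "l \<in> L" using kL unfolding tight_def by blast
      have "row A l \<bullet> w = 0"
      proof (cases "l = k")
        case True
        show ?thesis unfolding True w[OF kL] by simp
      next
        case False
        hence lr: "l \<in> tight r" using l by blast
        hence "row A l \<bullet> r = 0" unfolding tight_def by blast
        thus ?thesis unfolding w[OF lL] u(4)[OF lr] by simp
      qed
      thus "l \<in> tight w" using lL by (simp add: tight_def)
    qed
    have "tight y \<subseteq> tight w" using tw r(1) unfolding P_def by blast
    hence "P w" using wc wpos \<open>w \<noteq> 0\<^sub>v n\<close> unfolding P_def by blast
    hence "card (tight w) \<le> card (tight r)" by (rule r(2))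
    moreover have fin: "finite (tight x)" for x using finL by (simp add: tight_def)
    have "card (insert k (tight r)) \<le> card (tight w)" by (rule card_mono[OF fin tw])
    moreover have "k \<notin> tight r" using kr by (simp add: tight_def)
    hence "card (insert k (tight r)) = Suc (card (tight r))" using fin by (rule card_insert_disjoint[rotated])
    ultimately show False by linarith
  qed
  moreover have "tight r \<subseteq> {0..<m}" using L unfolding tight_def by blast
  moreover have "row A i \<bullet> r = 0" if "i \<in> tight r" for i using that unfolding tight_def by blast
  ultimately obtain I where I: "I \<subseteq> tight r" "card I = n - 1" "trivial_kernel A (insert q I)"
    using facet_rows_of_ray[OF A _ Lm[OF q(1)] rc _ q(2), of "tight r"] by blast
  moreover have "I \<subseteq> L" "\<forall>i \<in> I. row A i \<bullet> r = 0" using I(1) unfolding tight_def by blast+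
  moreover have "\<forall>l \<in> L. row A l \<bullet> y = 0 \<longrightarrow> row A l \<bullet> r = 0"
    using r(1) unfolding P_def tight_def by blast
  ultimately show ?thesis using rc rpos q(1) qpos by blast
qed

lemma det_bordered_nonzero:
  fixes A :: "int mat"
  assumes A: "A \<in> carrier_mat m n" and I: "I \<subseteq> {0..<m}" and cI: "card I = n - 1" and n: "0 < n"
    and q: "q < m" and ker: "trivial_kernel A (insert q I)"
  shows "det (bordered A I (row A q)) \<noteq> 0"
proof
  assume "det (bordered A I (row A q)) = 0"
  then obtain x where x: "x \<in> carrier_vec n" "x \<noteq> 0\<^sub>v n"
    and z: "bordered A I (row A q) *\<^sub>v x = 0\<^sub>v n"
    using det_0_iff_vec_prod_zero[OF bordered_carrier[OF A]] by blast
  have rq: "row A q \<in> carrier_vec n" using A q by auto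
  have "row A q \<bullet> x = 0"
    using bordered_mult[OF A I cI n rq x(1), of "n - 1"] z n by simp
  moreover have "row A i \<bullet> x = 0" if i: "i \<in> I" for i
  proof -
    obtain k where k: "k < n - 1" "pick I k = i" using index_is_pick[OF I i] cI by auto
    have "k < n" using k by simp
    thus ?thesis using bordered_mult[OF A I cI n rq x(1), of k] z k by simp
  qed
  ultimately show False using ker x A unfolding trivial_kernel_def by auto
qed

text \<open>The generator of the ray found by \<open>ray_below\<close> is replaced by the signed minors of its tight rows,
  oriented into the cone; this is where bounds on the minors of \<open>A\<close> become bounds on the generator.\<close>

lemma minor_ray_below:
  assumes A: "A \<in> carrier_mat m n" and L: "L \<subseteq> {0..<m}" and ker: "trivial_kernel A L"
    and y: "y \<in> carrier_vec n" "y \<noteq> 0\<^sub>v n" "\<And>l. l \<in> L \<Longrightarrow> 0 \<le> row A l \<bullet> y"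
  shows "\<exists>p I q. (p = signed_minors A I \<or> p = - signed_minors A I) \<and> (\<forall>l \<in> L. 0 \<le> row A l \<bullet> p) \<and>
    (\<forall>l \<in> L. row A l \<bullet> y = 0 \<longrightarrow> row A l \<bullet> p = 0) \<and>
    I \<subseteq> L \<and> card I = n - 1 \<and> q \<in> L \<and> 0 < row A q \<bullet> p"
proof -
  obtain r I q where r: "r \<in> carrier_vec n" "\<And>l. l \<in> L \<Longrightarrow> 0 \<le> row A l \<bullet> r"
    "\<And>l. l \<in> L \<Longrightarrow> row A l \<bullet> y = 0 \<Longrightarrow> row A l \<bullet> r = 0"
    and I: "I \<subseteq> L" "card I = n - 1" "\<And>i. i \<in> I \<Longrightarrow> row A i \<bullet> r = 0"
    and q: "q \<in> L" "0 < row A q \<bullet> r" "trivial_kernel A (insert q I)"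
    using ray_below[OF A L ker y] by blast
  have n: "0 < n" using y(1,2) by (cases n) auto
  have Im: "I \<subseteq> {0..<m}" and qm: "q < m" using I(1) L q(1) by auto
  define s :: int where "s = sgn ((- 1) ^ n * det (bordered A I (row A q)))"
  define D where "D = \<bar>det (bordered A I (row A q))\<bar>"
  have det0: "det (bordered A I (row A q)) \<noteq> 0"
    by (rule det_bordered_nonzero[OF A Im I(2) n qm q(3)])
  have D: "0 < D" using det0 by (simp add: D_def)
  have s: "s = 1 \<or> s = - 1" using det0 by (auto simp: s_def sgn_if)
  define p where "p = s \<cdot>\<^sub>v signed_minors A I"
  have pc: "p \<in> carrier_vec n" using A by (simp add: p_def)
  have rq: "row A q \<in> carrier_vec n" using A qm by auto
  have "D \<cdot>\<^sub>v r = (row A q \<bullet> r) \<cdot>\<^sub>v p"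
  proof (rule eq_vecI)
    fix j assume "j < dim_vec ((row A q \<bullet> r) \<cdot>\<^sub>v p)"
    hence j: "j < n" using pc by simp
    have sD: "s * (- 1) ^ n * det (bordered A I (row A q)) = D"
      unfolding s_def D_def by (cases "even n") (auto simp: abs_if sgn_if)
    have "D * r $ j = s * (- 1) ^ n * (det (bordered A I (row A q)) * r $ j)"
      unfolding sD[symmetric] by simp
    also have "det (bordered A I (row A q)) * r $ j
        = (- 1) ^ n * (row A q \<bullet> r) * signed_minors A I $ j"
      using cramer_bordered[OF A Im I(2) n rq r(1) I(3) j] .
    also have "s * (- 1) ^ n * ((- 1) ^ n * (row A q \<bullet> r) * signed_minors A I $ j)
        = s * (((- 1) ^ n * (- 1) ^ n) * (row A q \<bullet> r) * signed_minors A I $ j)"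
      by (simp only: mult_ac)
    also have "(- 1 :: int) ^ n * (- 1) ^ n = 1" by (simp flip: power_add mult_2)
    finally show "(D \<cdot>\<^sub>v r) $ j = ((row A q \<bullet> r) \<cdot>\<^sub>v p) $ j"
      using j carrier_vecD[OF r(1)] carrier_vecD[OF signed_minors_carrier[OF A, of I]]
      by (simp add: p_def mult_ac)
  qed (use r pc in auto)
  hence scale: "D * (row A l \<bullet> r) = (row A q \<bullet> r) * (row A l \<bullet> p)" if "l < m" for l
    using that A r(1) pc by (metis scalar_prod_smult_distrib row_carrier_vec)
  have "0 \<le> row A l \<bullet> p" if "l \<in> L" for l
  proof -
    have "0 \<le> D * (row A l \<bullet> r)" using r(2)[OF that] D by simp
    hence "0 \<le> (row A q \<bullet> r) * (row A l \<bullet> p)" using scale[of l] that L by auto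
    thus ?thesis using q(2) by (simp add: zero_le_mult_iff)
  qed
  moreover have "row A l \<bullet> p = 0" if "l \<in> L" "row A l \<bullet> y = 0" for l
    using scale[of l] that L r(3)[OF that] q(2) by auto
  moreover have "0 < row A q \<bullet> p" using scale[OF qm] q(2) D by auto
  moreover have "p = signed_minors A I \<or> p = - signed_minors A I"
    using s A by (auto simp: p_def)
  ultimately show ?thesis using I q by blast
qed

lemma trivial_kernel_of_maximal_minor:
  fixes A :: "int mat"
  assumes A: "A \<in> carrier_mat m n" and pos: "0 < max_minor A" and le: "n \<le> m"
  shows "trivial_kernel A {0..<m}"
proof -
  have "det (submatrix A {0..<n} {0..<n}) \<in> minors (dim_col A) A"
    using A le unfolding minors_def by (force intro!: exI[of _ "{0..<n}"])
  hence "max_minor A \<in> abs ` minors (dim_col A) A"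
    unfolding max_minor_def using finite_minors by (intro Max_in) auto
  then obtain K J where K: "K \<subseteq> {0..<m}" "J \<subseteq> {0..<n}" "card K = n" "card J = n"
    and d: "\<bar>det (submatrix A K J)\<bar> = max_minor A"
    using A unfolding minors_def by auto
  have J: "J = {0..<n}" using K by (intro card_subset_eq) auto
  define S where "S = submatrix A K J"
  have S: "S \<in> carrier_mat n n"
    using A K J restricted_index_set[OF K(1)] by (auto simp: S_def dim_submatrix)
  have rowS: "row S i = row A (pick K i)" if "i < n" for i
  proof (rule eq_vecI)
    show "row S i $ j = row A (pick K i) $ j" if "j < dim_vec (row A (pick K i))" for j
      using S A K J \<open>i < n\<close> that pick_in_index_set[OF K(1)] restricted_index_set[OF K(1)]
      by (simp, simp add: S_def, subst submatrix_index) (auto simp: pick_initial_segment)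
  qed (use S A in auto)
  show ?thesis unfolding trivial_kernel_def
  proof (intro ballI impI)
    fix x assume x: "x \<in> carrier_vec (dim_col A)" and z: "\<forall>l \<in> {0..<m}. row A l \<bullet> x = 0"
    have "row A (pick K i) \<bullet> x = 0" if "i < n" for i
      using z pick_in_index_set(2)[OF K(1)] K(3) that by auto
    hence "S *\<^sub>v x = 0\<^sub>v n" using S rowS by (intro eq_vecI) auto
    moreover have "det S \<noteq> 0" using d pos by (auto simp: S_def)
    ultimately show "x = 0\<^sub>v (dim_col A)" using det_0_iff_vec_prod_zero[OF S] x A by auto
  qed
qed

section \<open>Indecomposable lattice points of bimodular cones\<close>

definition lattice_cone :: "int mat \<Rightarrow> int vec set" where
  "lattice_cone A = {x \<in> carrier_vec (dim_col A). \<forall>l < dim_row A. 0 \<le> row A l \<bullet> x}"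

definition primitive :: "int vec \<Rightarrow> bool" where
  "primitive p \<longleftrightarrow> (\<forall>d. (\<forall>j < dim_vec p. d dvd p $ j) \<longrightarrow> d dvd 1)"

text \<open>The zero vector is indecomposable in this sense.\<close>

definition indecomposable :: "int mat \<Rightarrow> int vec \<Rightarrow> bool" where
  "indecomposable A h \<longleftrightarrow> h \<in> lattice_cone A \<and> (\<forall>z1 \<in> lattice_cone A. \<forall>z2 \<in> lattice_cone A.
     h = z1 + z2 \<longrightarrow> z1 = 0\<^sub>v (dim_col A) \<or> z2 = 0\<^sub>v (dim_col A))"

lemma primitive_dvd:
  assumes "primitive p" and "\<And>j. j < dim_vec p \<Longrightarrow> d dvd c * p $ j"
  shows "d dvd c"
proof -
  define E where "E = ($) p ` {..<dim_vec p}"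
  have "Gcd E dvd p $ j" if "j < dim_vec p" for j using that by (auto simp: E_def)
  hence unit: "Gcd E dvd 1" using assms(1) unfolding primitive_def by blast
  have "d dvd Gcd ((*) c ` E)" using assms(2) by (auto simp: E_def intro!: Gcd_greatest)
  hence "d dvd c * Gcd E" by (simp add: Gcd_mult)
  thus ?thesis using unit by (simp add: dvd_mult_unit_iff)
qed

locale bimodular_rows =
  fixes A :: "int mat" and m n :: nat
  assumes A: "A \<in> carrier_mat m n" and max_minor: "max_minor A = 2" and n: "0 < n"
begin

definition facet_vector :: "nat set \<Rightarrow> int vec \<Rightarrow> bool" where
  "facet_vector I p \<longleftrightarrow> I \<subseteq> {0..<m} \<and> card I = n - 1 \<and>
     (p = signed_minors A I \<or> p = - signed_minors A I)"

lemma facet_vectorD: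
  assumes "facet_vector I p"
  shows "I \<subseteq> {0..<m}" "card I = n - 1" "p \<in> carrier_vec n" "\<And>i. i \<in> I \<Longrightarrow> row A i \<bullet> p = 0"
    and "l < m \<Longrightarrow> \<bar>row A l \<bullet> p\<bar> = \<bar>det (bordered A I (row A l))\<bar>"
    and "l < m \<Longrightarrow> \<bar>row A l \<bullet> p\<bar> \<le> 2"
    and "j < n \<Longrightarrow> \<bar>p $ j\<bar> = \<bar>signed_minors A I $ j\<bar>"
proof -
  show I: "I \<subseteq> {0..<m}" "card I = n - 1" and pc: "p \<in> carrier_vec n"
    using assms A by (auto simp: facet_vector_def)
  have *: "row A l \<bullet> p = row A l \<bullet> signed_minors A I \<or> row A l \<bullet> p = - (row A l \<bullet> signed_minors A I)"
    if "l < m" for l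
  proof -
    have "row A l \<bullet> - signed_minors A I = - (row A l \<bullet> signed_minors A I)"
      using A that by (intro scalar_prod_uminus_right) (simp add: signed_minors_def)
    thus ?thesis using assms by (auto simp: facet_vector_def)
  qed
  show "row A i \<bullet> p = 0" if "i \<in> I" for i
    using *[of i] signed_minors_orthogonal[OF A I n that] that I by auto
  show eq: "\<bar>row A l \<bullet> p\<bar> = \<bar>det (bordered A I (row A l))\<bar>" if "l < m"
  proof -
    have "row A l \<in> carrier_vec n" using A that by auto
    thus ?thesis using *[OF that] det_bordered[OF A I n, of "row A l"] by (auto simp: abs_mult power_abs)
  qed
  show "\<bar>row A l \<bullet> p\<bar> \<le> 2" if "l < m"
    using eq[OF that] det_bordered_le[OF A I that] max_minor by simp
  show "\<bar>p $ j\<bar> = \<bar>signed_minors A I $ j\<bar>" if "j < n"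
    using assms that carrier_vecD[OF signed_minors_carrier[OF A, of I]]
    by (auto simp: facet_vector_def)
qed

text \<open>If \<open>p = g q\<close> with \<open>g > 0\<close>, then \<open>h - q\<close> leaves the cone, for otherwise \<open>h = q + (h - q)\<close> forces
  \<open>h = q\<close>, although \<open>p\<close> is no multiple of \<open>h\<close>. So there is a row with \<open>a\<^sub>k \<bullet> q > a\<^sub>k \<bullet> h \<ge> 1\<close>,
  that is \<open>a\<^sub>k \<bullet> p \<ge> 2g\<close>. The bound 2 leaves only \<open>g = 1\<close> and equality. Finally \<open>2h - p\<close> lies in the cone because \<open>a\<^sub>l \<bullet> p \<le> 2\<close>, and
  \<open>a\<^sub>l \<bullet> h \<ge> 1\<close> whenever \<open>a\<^sub>l \<bullet> p > 0\<close>.\<close>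

lemma generator_below_indecomposable:
  assumes h: "indecomposable A h" and p: "facet_vector I p" "p \<in> lattice_cone A" "p \<noteq> 0\<^sub>v n"
    and tight: "\<And>l. l < m \<Longrightarrow> row A l \<bullet> h = 0 \<Longrightarrow> row A l \<bullet> p = 0"
    and off: "\<And>g. p \<noteq> g \<cdot>\<^sub>v h"
  shows "primitive p" and "\<exists>k < m. row A k \<bullet> p = 2 \<and> row A k \<bullet> h = 1"
    and "2 \<cdot>\<^sub>v h - p \<in> lattice_cone A"
proof -
  have hc: "h \<in> carrier_vec n" and hpos: "\<And>l. l < m \<Longrightarrow> 0 \<le> row A l \<bullet> h"
    using h A by (auto simp: indecomposable_def lattice_cone_def)
  have ppos: "\<And>l. l < m \<Longrightarrow> 0 \<le> row A l \<bullet> p" using p(2) A by (auto simp: lattice_cone_def)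
  note D = facet_vectorD[OF p(1)]
  have p2: "row A l \<bullet> p \<le> 2" if "l < m" for l using D(6)[OF that] by simp
  have rc: "row A l \<in> carrier_vec n" if "l < m" for l using A that by auto
  have exceeds: "\<exists>k < m. row A k \<bullet> h < row A k \<bullet> q"
    if q: "q \<in> carrier_vec n" "p = g \<cdot>\<^sub>v q" "0 < g" for q g
  proof (rule ccontr)
    assume no: "\<not> ?thesis"
    have "row A l \<bullet> p = g * (row A l \<bullet> q)" if "l < m" for l
      using q rc[OF that] by simp
    hence "q \<in> lattice_cone A"
      using q(1,3) ppos A by (auto simp: lattice_cone_def zero_le_mult_iff dest: leD)
    moreover have "h - q \<in> lattice_cone A"
    proof -
      have "0 \<le> row A l \<bullet> (h - q)" if l: "l < m" for l
      proof -
        have "row A l \<bullet> q \<le> row A l \<bullet> h" using no l by (meson not_less)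
        thus ?thesis using rc[OF l] q(1) hc by (simp add: scalar_prod_minus_distrib[of _ n])
      qed
      thus ?thesis using A q(1) hc by (auto simp: lattice_cone_def)
    qed
    moreover have "h = q + (h - q)" using hc q(1) by auto
    ultimately have "q = 0\<^sub>v n \<or> h - q = 0\<^sub>v n" using h A unfolding indecomposable_def by auto
    thus False
    proof
      assume "q = 0\<^sub>v n" thus False using q(2) p(3) by auto
    next
      assume z: "h - q = 0\<^sub>v n"
      have "h = q"
      proof (rule eq_vecI)
        fix i assume "i < dim_vec q"
        thus "h $ i = q $ i" using z hc q(1) by (metis carrier_vecD eq_iff_diff_eq_0 index_minus_vec(1) index_zero_vec(1))
      qed (use hc q(1) in auto)
      thus False using off q(2) by blast
    qed
  qed
  have hp: "1 \<le> row A l \<bullet> h" if "l < m" "0 < row A l \<bullet> p" for l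
    using hpos[OF that(1)] tight[OF that(1)] that(2) by fastforce
  obtain k where k: "k < m" "row A k \<bullet> h < row A k \<bullet> p"
    using exceeds[of p 1] D(3) by auto
  moreover have "0 < row A k \<bullet> p" using k hpos[of k] by simp
  ultimately have "row A k \<bullet> p = 2" "row A k \<bullet> h = 1" using hp[of k] p2[of k] by auto
  thus "\<exists>k < m. row A k \<bullet> p = 2 \<and> row A k \<bullet> h = 1" using k(1) by blast
  show "2 \<cdot>\<^sub>v h - p \<in> lattice_cone A"
  proof -
    have "0 \<le> row A l \<bullet> (2 \<cdot>\<^sub>v h - p)" if l: "l < m" for l
    proof -
      have "row A l \<bullet> (2 \<cdot>\<^sub>v h - p) = 2 * (row A l \<bullet> h) - row A l \<bullet> p"
        using hc D(3) rc[OF l] by (simp add: scalar_prod_minus_distrib[of _ n])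
      thus ?thesis using hp[OF l] p2[OF l] hpos[OF l] ppos[OF l] by (cases "row A l \<bullet> p = 0") auto
    qed
    thus ?thesis using A hc D(3) by (auto simp: lattice_cone_def)
  qed
  show "primitive p" unfolding primitive_def
  proof (intro allI impI)
    fix d assume d: "\<forall>j < dim_vec p. d dvd p $ j"
    show "d dvd 1"
    proof (rule ccontr)
      assume nd: "\<not> d dvd 1"
      define g where "g = \<bar>d\<bar>"
      define q where "q = vec n (\<lambda>j. p $ j div g)"
      have pq: "p = g \<cdot>\<^sub>v q" using d D(3) by (intro eq_vecI) (auto simp: q_def g_def)
      have "g \<noteq> 0" using pq p(3) D(3) by (auto simp: q_def)
      hence g: "2 \<le> g" using nd by (auto simp: g_def)
      have qc: "q \<in> carrier_vec n" by (simp add: q_def)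
      obtain l where l: "l < m" "row A l \<bullet> h < row A l \<bullet> q" using exceeds[OF qc pq] g by auto
      have e: "row A l \<bullet> p = g * (row A l \<bullet> q)" using pq qc rc[OF l(1)] by simp
      have "0 < row A l \<bullet> q" using l hpos[OF l(1)] by simp
      hence "0 < row A l \<bullet> p" using e g by simp
      hence "2 \<le> row A l \<bullet> q" using hp[OF l(1)] l(2) by simp
      hence "2 * 2 \<le> row A l \<bullet> p" unfolding e using g by (intro mult_mono) auto
      thus False using p2[OF l(1)] by simp
    qed
  qed
qed


text \<open>The edge walk from the vertex \<open>p/2\<close> of \<open>C \<inter> (h - C)\<close> to the lattice point \<open>h\<close>. All vectors are
  doubled to stay integral: \<open>w = 2h - p\<close> stands for \<open>h - p/2\<close>, and the edge found is \<open>d/2\<close>. The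
  rows tight at \<open>p/2\<close> are those in \<open>K\<close> (where the lower bound 0 is attained) and those in \<open>U\<close> (where the
  upper bound \<open>a\<^sub>l \<bullet> h\<close> is attained).\<close>

lemma indecomposable_is_half_sum:
  assumes le: "n \<le> m" and h: "indecomposable A h" "h \<noteq> 0\<^sub>v n"
    and off: "\<And>I p g. facet_vector I p \<Longrightarrow> p \<in> lattice_cone A \<Longrightarrow> p \<noteq> 0\<^sub>v n \<Longrightarrow> p \<noteq> g \<cdot>\<^sub>v h"
  shows "\<exists>I p J w. facet_vector I p \<and> facet_vector J w \<and> p \<in> lattice_cone A \<and> w \<in> lattice_cone A \<and>
    primitive p \<and> primitive w \<and> (\<exists>k < m. row A k \<bullet> p = 2) \<and> (\<exists>k < m. row A k \<bullet> w = 2) \<and>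
    p \<noteq> w \<and> w = 2 \<cdot>\<^sub>v h - p"
proof -
  have hc: "h \<in> carrier_vec n" and hpos: "\<And>l. l < m \<Longrightarrow> 0 \<le> row A l \<bullet> h"
    using h A by (auto simp: indecomposable_def lattice_cone_def)
  have rc: "row A l \<in> carrier_vec n" if "l < m" for l using A that by auto
  have ker: "trivial_kernel A {0..<m}"
    using trivial_kernel_of_maximal_minor[OF A _ le] max_minor by simp
  obtain p I q where pI: "p = signed_minors A I \<or> p = - signed_minors A I"
    and p: "\<And>l. l < m \<Longrightarrow> 0 \<le> row A l \<bullet> p" "\<And>l. l < m \<Longrightarrow> row A l \<bullet> h = 0 \<Longrightarrow> row A l \<bullet> p = 0"
    and I: "I \<subseteq> {0..<m}" "card I = n - 1" and q: "q < m" "0 < row A q \<bullet> p"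
    using minor_ray_below[OF A subset_refl ker hc h(2)] hpos
    by (metis atLeastLessThan_iff zero_le)
  have pf: "facet_vector I p" using pI I by (simp add: facet_vector_def)
  note P = facet_vectorD[OF pf]
  have pL: "p \<in> lattice_cone A" using P(3) p(1) A by (auto simp: lattice_cone_def)
  have p0: "p \<noteq> 0\<^sub>v n" using q A by auto
  have gen: "primitive p" "\<exists>k < m. row A k \<bullet> p = 2 \<and> row A k \<bullet> h = 1" "2 \<cdot>\<^sub>v h - p \<in> lattice_cone A"
    using generator_below_indecomposable[OF h(1) pf pL p0 _ off[OF pf pL p0]] p(2) by blast+
  obtain k where k: "k < m" "row A k \<bullet> p = 2" "row A k \<bullet> h = 1" using gen(2) by blast
  define w where "w = 2 \<cdot>\<^sub>v h - p"
  have wL: "w \<in> lattice_cone A" using gen(3) by (simp add: w_def)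
  have wc: "w \<in> carrier_vec n" using hc P(3) by (simp add: w_def)
  have row_w: "row A l \<bullet> w = 2 * (row A l \<bullet> h) - row A l \<bullet> p" if "l < m" for l
    using hc P(3) rc[OF that] by (simp add: w_def scalar_prod_minus_distrib[of _ n])
  have wpos: "0 \<le> row A l \<bullet> w" if "l < m" for l
    using wL that A by (simp add: lattice_cone_def)
  define K where "K = {l. l < m \<and> row A l \<bullet> p = 0}"
  define U where "U = {l. l < m \<and> row A l \<bullet> p = 2 \<and> row A l \<bullet> h = 1}"
  define L where "L = K \<union> U"
  have Lm: "L \<subseteq> {0..<m}" and finK: "finite K" by (auto simp: L_def K_def U_def)
  have Lmem: "l < m" if "l \<in> L" for l using that Lm by auto
  have IK: "I \<subseteq> K" using P(4) I(1) by (auto simp: K_def)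
  have kU: "k \<in> U" using k by (simp add: U_def)
  have kerL: "trivial_kernel A L" unfolding trivial_kernel_def
  proof (intro ballI impI)
    fix x assume "x \<in> carrier_vec (dim_col A)" and z: "\<forall>l \<in> L. row A l \<bullet> x = 0"
    hence x: "x \<in> carrier_vec n" using A by simp
    have d0: "det (bordered A I (row A k)) \<noteq> 0" using P(5)[OF k(1)] k(2) by auto
    have "x $ j = 0" if j: "j < n" for j
    proof -
      have "row A i \<bullet> x = 0" if "i \<in> I" for i using z IK that by (auto simp: L_def)
      moreover have "row A k \<bullet> x = 0" using z kU by (auto simp: L_def)
      ultimately have "det (bordered A I (row A k)) * x $ j = 0"
        using cramer_bordered[OF A I n rc[OF k(1)] x _ j] by simp
      thus ?thesis using d0 by simp
    qed
    thus "x = 0\<^sub>v (dim_col A)" using x A by (intro eq_vecI) auto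
  qed
  have odd_p: "\<exists>j < n. odd (p $ j)"
    using gen(1) P(3) unfolding primitive_def by (metis carrier_vecD odd_one)
  (* S holds for the vectors of the smallest face of the tangent cone at p/2 that contains w, as far
     as they have even values on K and are not divisible by 2. *)
  define S where "S z \<longleftrightarrow> z \<in> carrier_vec n \<and> (\<forall>l \<in> K. 0 \<le> row A l \<bullet> z \<and> even (row A l \<bullet> z)) \<and>
    (\<forall>l \<in> U. row A l \<bullet> z = 0) \<and> (\<forall>l \<in> K. row A l \<bullet> w = 0 \<longrightarrow> row A l \<bullet> z = 0) \<and>
    (\<exists>j < n. odd (z $ j))" for z
  define weight where "weight z = nat (\<Sum>l\<in>K. row A l \<bullet> z)" for z
  have "S w"
  proof -
    have "even (row A l \<bullet> w)" if "l \<in> K" for l using row_w[of l] that by (simp add: K_def)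
    moreover have "row A l \<bullet> w = 0" if "l \<in> U" for l using row_w[of l] that by (simp add: U_def)
    moreover have "\<exists>j < n. odd (w $ j)" using odd_p hc P(3) by (auto simp: w_def)
    moreover have "0 \<le> row A l \<bullet> w" if "l \<in> K" for l using wpos that by (simp add: K_def)
    ultimately show ?thesis using wc unfolding S_def by blast
  qed
  then obtain z where z: "S z" "\<And>y. S y \<Longrightarrow> weight z \<le> weight y"
    using ex_has_least_nat[of S w weight] by blast
  have zc: "z \<in> carrier_vec n" and z0: "z \<noteq> 0\<^sub>v n" using z(1) by (auto simp: S_def)
  have zL: "0 \<le> row A l \<bullet> z" if "l \<in> L" for l using z(1) that by (auto simp: S_def L_def)
  obtain d J q' where dJ: "d = signed_minors A J \<or> d = - signed_minors A J"
    and d: "\<And>l. l \<in> L \<Longrightarrow> 0 \<le> row A l \<bullet> d" "\<And>l. l \<in> L \<Longrightarrow> row A l \<bullet> z = 0 \<Longrightarrow> row A l \<bullet> d = 0"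
    and J: "J \<subseteq> L" "card J = n - 1" and q': "q' \<in> L" "0 < row A q' \<bullet> d"
    using minor_ray_below[OF A Lm kerL zc z0 zL] by blast
  have df: "facet_vector J d" using dJ J Lm by (auto simp: facet_vector_def)
  note D = facet_vectorD[OF df]
  have dU: "row A l \<bullet> d = 0" if "l \<in> U" for l
    using d(2)[of l] z(1) that by (auto simp: S_def L_def)
  have dvals: "row A l \<bullet> d = 0 \<or> row A l \<bullet> d = 2" if l: "l \<in> L" for l
  proof -
    have ev: "even (row A i \<bullet> p)" if "i \<in> L" for i using that by (auto simp: L_def K_def U_def)
    have evJ: "2 dvd row A i \<bullet> p" if "i \<in> J" for i using ev that J(1) by blast
    have div: "2 dvd det (bordered A J (row A l)) * p $ j" if "j < n" for j
      by (rule dvd_det_bordered[OF A D(1,2) n rc[OF Lmem[OF l]] P(3) evJ ev[OF l] that])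
    have "2 dvd det (bordered A J (row A l))"
      by (rule primitive_dvd[OF gen(1), unfolded carrier_vecD[OF P(3)], OF div])
    hence "even \<bar>row A l \<bullet> d\<bar>" unfolding D(5)[OF Lmem[OF l]] by simp
    then obtain c where c: "row A l \<bullet> d = 2 * c" by (auto elim: evenE)
    have "0 \<le> c" "c \<le> 1" using d(1)[OF l] D(6)[OF Lmem[OF l]] c by auto
    thus ?thesis using c by auto
  qed
  (* If d were divisible by 2, then z - d would also satisfy S, contrary to the minimality of z. *)
  have odd_d: "\<exists>j < n. odd (d $ j)"
  proof (rule ccontr)
    assume no: "\<not> ?thesis"
    define y where "y = z - d"
    have row_y: "row A l \<bullet> y = row A l \<bullet> z - row A l \<bullet> d" if "l < m" for l
      using zc D(3) rc[OF that] by (simp add: y_def scalar_prod_minus_distrib[of _ n])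
    have Ky: "0 \<le> row A l \<bullet> y \<and> even (row A l \<bullet> y) \<and> (row A l \<bullet> z = 0 \<longrightarrow> row A l \<bullet> y = 0)"
      if l: "l \<in> K" for l
    proof -
      have lL: "l \<in> L" using l by (simp add: L_def)
      have "even (row A l \<bullet> z)" "0 \<le> row A l \<bullet> z" using z(1) l by (auto simp: S_def)
      moreover have "2 \<le> row A l \<bullet> z" if "row A l \<bullet> z \<noteq> 0"
      proof -
        obtain c where "row A l \<bullet> z = 2 * c" using \<open>even (row A l \<bullet> z)\<close> by (rule evenE)
        thus ?thesis using that \<open>0 \<le> row A l \<bullet> z\<close> by simp
      qed
      ultimately show ?thesis using row_y[OF Lmem[OF lL]] dvals[OF lL] d(2)[OF lL]
        by (cases "row A l \<bullet> z = 0") auto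
    qed
    have Uy: "row A l \<bullet> y = 0" if l: "l \<in> U" for l
    proof -
      have lL: "l \<in> L" using l by (simp add: L_def)
      thus ?thesis using row_y[OF Lmem[OF lL]] dU[OF l] z(1) l by (simp add: S_def)
    qed
    have "\<exists>j < n. odd (y $ j)" using z(1) no D(3) zc by (auto simp: S_def y_def)
    moreover have "y \<in> carrier_vec n" using zc D(3) by (simp add: y_def)
    ultimately have "S y" using Ky Uy z(1) unfolding S_def by blast
    hence "weight z \<le> weight y" by (rule z(2))
    moreover have "weight y < weight z"
    proof -
      have q'K: "q' \<in> K" using q' dU by (force simp: L_def)
      have "(\<Sum>l\<in>K. row A l \<bullet> y) < (\<Sum>l\<in>K. row A l \<bullet> z)"
      proof (rule sum_strict_mono_ex1[OF finK])
        show "\<forall>l \<in> K. row A l \<bullet> y \<le> row A l \<bullet> z"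
          using row_y Lmem d(1) by (simp add: L_def)
        show "\<exists>l \<in> K. row A l \<bullet> y < row A l \<bullet> z"
          by (rule bexI[OF _ q'K]) (simp add: row_y[OF Lmem[OF q'(1)]] q'(2))
      qed
      moreover have "0 \<le> (\<Sum>l\<in>K. row A l \<bullet> y)" using Ky by (intro sum_nonneg) auto
      ultimately show ?thesis by (simp add: weight_def)
    qed
    ultimately show False by simp
  qed
  (* Modulo 2 the rows in I have only the multiples of p in their kernel: bordering them with a unit
     vector at an odd entry of p gives an odd determinant. *)
  have cong: "even (p $ j + d $ j)" if j: "j < n" for j
  proof -
    obtain i where i: "i < n" "odd (p $ i)" using odd_p by blast
    have e: "unit_vec n i \<in> carrier_vec n" by simp
    have odd_det: "odd (det (bordered A I (unit_vec n i)))"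
    proof -
      have "unit_vec n i \<bullet> signed_minors A I = signed_minors A I $ i"
        using A i(1) by (intro scalar_prod_left_unit) auto
      moreover have "odd \<bar>signed_minors A I $ i\<bar>" unfolding P(7)[OF i(1), symmetric] using i(2) by simp
      ultimately show ?thesis unfolding det_bordered[OF A I n e] by simp
    qed
    define y where "y = d - (d $ i) \<cdot>\<^sub>v p"
    have yc: "y \<in> carrier_vec n" using D(3) P(3) by (simp add: y_def)
    have "2 dvd row A l \<bullet> y" if l: "l \<in> I" for l
    proof -
      have "l \<in> L" "l < m" using l IK I(1) by (auto simp: L_def)
      moreover have "row A l \<bullet> y = row A l \<bullet> d - d $ i * (row A l \<bullet> p)"
        using rc[OF \<open>l < m\<close>] D(3) P(3) by (simp add: y_def scalar_prod_minus_distrib[of _ n])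
      ultimately show ?thesis using dvals[of l] P(4)[OF l] by auto
    qed
    moreover have "2 dvd unit_vec n i \<bullet> y"
    proof -
      have "unit_vec n i \<bullet> y = d $ i - d $ i * p $ i"
        using i(1) D(3) P(3) scalar_prod_left_unit[OF yc i(1)] by (simp add: y_def)
      thus ?thesis using i(2) by simp
    qed
    ultimately have "2 dvd det (bordered A I (unit_vec n i)) * y $ j'" if "j' < n" for j'
      using dvd_det_bordered[OF A I n e yc _ _ that] by blast
    hence ev: "even (d $ j' - d $ i * p $ j')" if "j' < n" for j'
      using odd_det that D(3) P(3) by (force simp: y_def)
    moreover have "odd (d $ i)" using odd_d ev by force
    ultimately show ?thesis using j by force
  qed
  define x where "x = vec n (\<lambda>j. (p $ j + d $ j) div 2)"
  have xc: "x \<in> carrier_vec n" by (simp add: x_def)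
  have x2: "2 \<cdot>\<^sub>v x = p + d" using cong P(3) D(3) by (intro eq_vecI) (auto simp: x_def)
  have row_x: "2 * (row A l \<bullet> x) = row A l \<bullet> p + row A l \<bullet> d" if "l < m" for l
  proof -
    have "2 * (row A l \<bullet> x) = row A l \<bullet> (2 \<cdot>\<^sub>v x)" using rc[OF that] xc by simp
    thus ?thesis using rc[OF that] P(3) D(3) by (simp add: x2 scalar_prod_add_distrib[of _ n])
  qed
  (* Off the tight rows, p/2 is at distance at least 1/2 from both bounds, and d/2 changes the value
     by at most 1; integrality of x closes the remaining gap of 1/2. *)
  have bounds: "0 \<le> row A l \<bullet> x \<and> row A l \<bullet> x \<le> row A l \<bullet> h" if l: "l < m" for l
  proof -
    note facts = row_x[OF l] row_w[OF l] wpos[OF l] p(1)[OF l] hpos[OF l] p(2)[OF l]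
    have b: "\<bar>row A l \<bullet> p\<bar> \<le> 2" "\<bar>row A l \<bullet> d\<bar> \<le> 2" using P(6)[OF l] D(6)[OF l] .
    consider "l \<in> K" | "l \<in> U" | "l \<notin> K" "l \<notin> U" by blast
    thus ?thesis
    proof cases
      case 1
      hence lL: "l \<in> L" by (simp add: L_def)
      have "row A l \<bullet> d = 0" if "row A l \<bullet> w = 0"
        using d(2)[OF lL] z(1) 1 that by (simp add: S_def)
      moreover have "row A l \<bullet> p = 0" using 1 by (simp add: K_def)
      ultimately show ?thesis using facts dvals[OF lL] by (cases "row A l \<bullet> h = 0") auto
    next
      case 2
      thus ?thesis using facts dU[OF 2] by (simp add: U_def)
    next
      case 3
      hence "row A l \<bullet> p \<noteq> 0" "\<not> (row A l \<bullet> p = 2 \<and> row A l \<bullet> h = 1)"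
        using l by (auto simp: K_def U_def)
      moreover from this have "row A l \<bullet> p = 1 \<or> row A l \<bullet> p = 2" using facts(4) b(1) by linarith
      ultimately show ?thesis using facts b(2) by linarith
    qed
  qed
  have "x \<in> lattice_cone A" using bounds xc A by (simp add: lattice_cone_def)
  moreover have "h - x \<in> lattice_cone A"
    using bounds xc hc rc A by (simp add: lattice_cone_def scalar_prod_minus_distrib[of _ n])
  moreover have "h = x + (h - x)" using hc xc by auto
  ultimately have "x = 0\<^sub>v n \<or> h - x = 0\<^sub>v n" using h(1) A unfolding indecomposable_def by auto
  moreover have "row A k \<bullet> x = 1" using row_x[OF k(1)] dU[OF kU] k(2) by simp
  hence "x \<noteq> 0\<^sub>v n" using rc[OF k(1)] by auto
  ultimately have hx: "h - x = 0\<^sub>v n" by blast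
  have "w = d"
  proof (rule eq_vecI)
    fix j assume "j < dim_vec d"
    hence j: "j < n" using D(3) by simp
    have "h $ j - x $ j = 0" using arg_cong[OF hx, of "\<lambda>v. v $ j"] j xc hc by simp
    moreover have "2 * x $ j = p $ j + d $ j" using arg_cong[OF x2, of "\<lambda>v. v $ j"] j xc P(3) D(3) by simp
    ultimately show "w $ j = d $ j" using j hc P(3) by (simp add: w_def)
  qed (use wc D(3) in auto)
  hence wf: "facet_vector J w" using df by simp
  have w0: "w \<noteq> 0\<^sub>v n" using \<open>w = d\<close> q' Lmem rc by force
  have wt: "row A l \<bullet> w = 0" if "l < m" "row A l \<bullet> h = 0" for l
    using row_w p(2) that by simp
  have gen': "primitive w" "\<exists>k < m. row A k \<bullet> w = 2 \<and> row A k \<bullet> h = 1"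
    using generator_below_indecomposable[OF h(1) wf wL w0 _ off[OF wf wL w0]] wt by blast+
  have "p \<noteq> w" using row_w[OF k(1)] k by auto
  thus ?thesis using pf wf pL wL gen(1) gen'(1) gen'(2) k w_def by blast
qed

end

section \<open>Real cones, extreme rays and normalized generators\<close>

abbreviation real_mat :: "int mat \<Rightarrow> real mat" where
  "real_mat \<equiv> map_mat real_of_int"

abbreviation real_vec :: "int vec \<Rightarrow> real vec" where
  "real_vec \<equiv> map_vec real_of_int"

lemma row_real_vec:
  assumes "A \<in> carrier_mat m n" "l < m" "x \<in> carrier_vec n"
  shows "row (real_mat A) l \<bullet> real_vec x = real_of_int (row A l \<bullet> x)"
  using assms by (simp add: scalar_prod_def)

lemma cone_of_iff:
  assumes "A \<in> carrier_mat m n"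
  shows "x \<in> cone_of A \<longleftrightarrow> x \<in> carrier_vec n \<and> (\<forall>l < m. 0 \<le> row (real_mat A) l \<bullet> x)"
  using assms by (auto simp: cone_of_def less_eq_vec_def)

lemma real_vec_in_cone_iff:
  assumes "A \<in> carrier_mat m n" "x \<in> carrier_vec n"
  shows "real_vec x \<in> cone_of A \<longleftrightarrow> x \<in> lattice_cone A"
  using assms row_real_vec[OF assms(1) _ assms(2)] by (auto simp: cone_of_iff lattice_cone_def)

lemma int_points_are_integer_vectors:
  "x \<in> int_points n \<longleftrightarrow> (\<exists>y \<in> carrier_vec n. x = real_vec y)"
proof
  assume x: "x \<in> int_points n"
  define y where "y = vec n (\<lambda>i. \<lfloor>x $ i\<rfloor>)"
  have "x = real_vec y" using x by (intro eq_vecI) (auto simp: y_def int_points_def of_int_floor)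
  thus "\<exists>y \<in> carrier_vec n. x = real_vec y" by (auto simp: y_def)
qed (auto simp: int_points_def)

lemma submatrix_real_mat: "submatrix (real_mat A) I J = real_mat (submatrix A I J)"
proof (rule eq_matI)
  fix i j assume ij: "i < dim_row (real_mat (submatrix A I J))" "j < dim_col (real_mat (submatrix A I J))"
  hence "pick I i < dim_row A" "pick J j < dim_col A"
    by (auto simp: dim_submatrix intro!: pick_le)
  thus "submatrix (real_mat A) I J $$ (i, j) = real_mat (submatrix A I J) $$ (i, j)"
    using ij by (simp add: dim_submatrix submatrix_index)
qed (auto simp: dim_submatrix)

lemma signed_minors_real_mat: "signed_minors (real_mat A) I = real_vec (signed_minors A I)"
  by (intro eq_vecI) (auto simp: signed_minors_def submatrix_real_mat)

lemma minor_vec_eq: "minor_vec A I = real_vec (signed_minors A I)"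
  by (intro eq_vecI) (auto simp: minor_vec_def signed_minors_def)

lemma set_dim_ray:
  assumes p: "p \<in> carrier_vec n" "p \<noteq> 0\<^sub>v n"
  shows "set_dim n {t \<cdot>\<^sub>v p | t. 0 \<le> t} = 1"
proof -
  interpret vec_space "TYPE(real)" n .
  define D where "D = {x - y | x y. x \<in> {t \<cdot>\<^sub>v p | t. 0 \<le> t} \<and> y \<in> {t \<cdot>\<^sub>v p | t. 0 \<le> t}}"
  have pn: "{p} \<subseteq> carrier_vec n" and pV: "{p} \<subseteq> carrier V" using p by simp_all
  have p_in: "p \<in> span {p}" using in_own_span[of "{p}"] pn by blast
  have sub: "submodule class_ring (span {p}) V" using span_is_submodule pV by simp
  have DV: "D \<subseteq> span {p}"
  proof
    fix v assume "v \<in> D"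
    then obtain s t where v: "v = s \<cdot>\<^sub>v p - t \<cdot>\<^sub>v p" by (auto simp: D_def)
    have "v = (s - t) \<cdot>\<^sub>v p" using p(1) unfolding v by (intro eq_vecI) (auto simp: algebra_simps)
    thus "v \<in> span {p}" using smult_in_span[of "{p}" p "s - t"] pn p_in by simp
  qed
  have "p = 1 \<cdot>\<^sub>v p - 0 \<cdot>\<^sub>v p" using p(1) by (intro eq_vecI) auto
  hence "p \<in> D" unfolding D_def by (blast intro: zero_le_one order_refl)
  hence pD: "{p} \<subseteq> D" by simp
  have "span D = span {p}"
  proof
    show "span D \<subseteq> span {p}" using DV sub by (rule span_is_subset)
    show "span {p} \<subseteq> span D" by (rule span_is_monotone[OF pD])
  qed
  moreover have "lin_indpt {p}"
    using lin_dep_iff_in_span[of "{}" p] p span_empty by (simp add: finite_lin_indpt2)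
  hence "vectorspace.dim class_ring (span_vs {p}) = card {p}"
    using pV by (intro dim_span) (auto simp: maximal_def)
  ultimately show ?thesis unfolding set_dim_def D_def[symmetric] by simp
qed

lemma minors_row_submatrix:
  assumes A: "A \<in> carrier_mat m n" and I: "I \<subseteq> {0..<m}" and cI: "card I = n - 1" and n: "0 < n"
  shows "minors (n - 1) (row_submatrix A I) = {det (submatrix A I ({0..<n} - {j})) | j. j < n}"
proof -
  define M where "M = row_submatrix A I"
  have M: "M \<in> carrier_mat (n - 1) n"
    using submatrix_of_subsets(1)[OF A I subset_refl] cI carrier_matD(2)[OF A] by (simp add: M_def)
  have sub: "submatrix M {0..<n - 1} ({0..<n} - {j}) = submatrix A I ({0..<n} - {j})" if j: "j < n" for j
  proof (rule eq_matI)
    define J where "J = {0..<n} - {j}"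
    have J: "J \<subseteq> {0..<n}" "card J = n - 1" using j unfolding J_def by simp_all
    note cA = submatrix_of_subsets(1)[OF A I J(1)]
      and cM = submatrix_of_subsets(1)[OF M subset_refl J(1)]
    show "dim_row (submatrix M {0..<n - 1} ({0..<n} - {j})) = dim_row (submatrix A I ({0..<n} - {j}))"
      "dim_col (submatrix M {0..<n - 1} ({0..<n} - {j})) = dim_col (submatrix A I ({0..<n} - {j}))"
      unfolding J_def[symmetric] carrier_matD[OF cA] carrier_matD[OF cM] using cI by simp_all
    fix i k assume "i < dim_row (submatrix A I ({0..<n} - {j}))"
      "k < dim_col (submatrix A I ({0..<n} - {j}))"
    hence ik: "i < n - 1" "k < n - 1" unfolding J_def[symmetric] carrier_matD[OF cA] cI J(2) by simp_all
    have k': "pick J k < n" using pick_in_index_set(2)[OF J(1)] ik(2) J(2) by simp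
    have "submatrix M {0..<n - 1} J $$ (i, k) = M $$ (pick {0..<n - 1} i, pick J k)"
      by (rule submatrix_of_subsets(2)[OF M subset_refl J(1)]) (use ik J(2) in auto)
    also have "\<dots> = A $$ (pick I i, pick {0..<n} (pick J k))"
      unfolding pick_initial_segment[OF ik(1)] M_def carrier_matD(2)[OF A]
      by (rule submatrix_of_subsets(2)[OF A I subset_refl]) (use ik k' cI in auto)
    also have "\<dots> = submatrix A I J $$ (i, k)"
      unfolding pick_initial_segment[OF k']
      by (rule submatrix_of_subsets(2)[OF A I J(1), symmetric]) (use ik J(2) cI in auto)
    finally show "submatrix M {0..<n - 1} ({0..<n} - {j}) $$ (i, k)
      = submatrix A I ({0..<n} - {j}) $$ (i, k)" unfolding J_def .
  qed
  have cols: "\<exists>j < n. J = {0..<n} - {j}" if J: "J \<subseteq> {0..<n}" "card J = n - 1" for J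
  proof -
    have "finite J" using J(1) by (rule finite_subset) simp
    hence "card ({0..<n} - J) = 1" using J n by (simp add: card_Diff_subset)
    then obtain j where "{0..<n} - J = {j}" by (auto simp: card_1_singleton_iff)
    thus ?thesis using J(1) by (intro exI[of _ j]) auto
  qed
  show ?thesis
  proof (intro equalityI subsetI)
    fix d assume "d \<in> minors (n - 1) (row_submatrix A I)"
    then obtain K J where K: "K \<subseteq> {0..<n - 1}" "card K = n - 1" and J: "J \<subseteq> {0..<n}" "card J = n - 1"
      and d: "d = det (submatrix M K J)"
      unfolding minors_def M_def[symmetric] carrier_matD[OF M] by blast
    have "K = {0..<n - 1}" by (rule card_subset_eq) (use K in simp_all)
    moreover obtain j where j: "j < n" "J = {0..<n} - {j}" using cols[OF J] by blast
    ultimately have "d = det (submatrix A I ({0..<n} - {j}))" unfolding d using sub[OF j(1)] by (simp only:)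
    thus "d \<in> {det (submatrix A I ({0..<n} - {j})) | j. j < n}" using j(1) by blast
  next
    fix d assume "d \<in> {det (submatrix A I ({0..<n} - {j})) | j. j < n}"
    then obtain j where j: "j < n" "d = det (submatrix A I ({0..<n} - {j}))" by blast
    have "d = det (submatrix M {0..<n - 1} ({0..<n} - {j}))" unfolding j(2) sub[OF j(1)] ..
    moreover have "card ({0..<n} - {j}) = n - 1" "{0..<n} - {j} \<subseteq> {0..<n}" "card {0..<n - 1} = n - 1"
      using j(1) by simp_all
    ultimately show "d \<in> minors (n - 1) (row_submatrix A I)"
      unfolding minors_def M_def[symmetric] carrier_matD[OF M] by blast
  qed
qed

lemma gcd_row_submatrix:
  assumes A: "A \<in> carrier_mat m n" and I: "I \<subseteq> {0..<m}" and cI: "card I = n - 1" and n: "0 < n"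
  shows "gcd_mat (row_submatrix A I) = Gcd {signed_minors A I $ j | j. j < n}"
proof -
  have "dim_row (row_submatrix A I) = n - 1" "dim_col (row_submatrix A I) = n"
    unfolding carrier_matD(2)[OF A]
    using carrier_matD[OF submatrix_of_subsets(1)[OF A I subset_refl]] cI by auto
  hence "min (dim_row (row_submatrix A I)) (dim_col (row_submatrix A I)) = n - 1" by simp
  hence "gcd_mat (row_submatrix A I) = Gcd {det (submatrix A I ({0..<n} - {j})) | j. j < n}"
    unfolding gcd_mat_def by (simp only: minors_row_submatrix[OF assms])
  also have "{det (submatrix A I ({0..<n} - {j})) | j. j < n} = (\<lambda>j. det (submatrix A I ({0..<n} - {j}))) ` {..<n}"
    by (simp only: image_Collect lessThan_def)
  also have "Gcd \<dots> = Gcd (abs ` (\<lambda>j. det (submatrix A I ({0..<n} - {j}))) ` {..<n})"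
    by (rule Gcd_abs_eq[symmetric])
  also have "abs ` (\<lambda>j. det (submatrix A I ({0..<n} - {j}))) ` {..<n} = abs ` ($) (signed_minors A I) ` {..<n}"
    unfolding image_image
  proof (intro image_cong refl)
    fix j assume "j \<in> {..<n}"
    thus "\<bar>det (submatrix A I ({0..<n} - {j}))\<bar> = \<bar>signed_minors A I $ j\<bar>"
      using carrier_matD(2)[OF A] by (simp add: signed_minors_def abs_mult power_abs)
  qed
  also have "Gcd \<dots> = Gcd (($) (signed_minors A I) ` {..<n})" by (rule Gcd_abs_eq)
  also have "($) (signed_minors A I) ` {..<n} = {signed_minors A I $ j | j. j < n}"
    by (simp only: image_Collect lessThan_def)
  finally show ?thesis .
qed

lemma rank_row_submatrix:
  assumes A: "A \<in> carrier_mat m n" and I: "I \<subseteq> {0..<m}" and cI: "card I = n - 1"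
    and j: "j < n" "signed_minors A I $ j \<noteq> 0"
  shows "rank_mat (row_submatrix A I) = n - 1"
proof -
  have n: "0 < n" using j(1) by simp
  define M where "M = row_submatrix A I"
  have M: "M \<in> carrier_mat (n - 1) n"
    using submatrix_of_subsets(1)[OF A I subset_refl] cI carrier_matD(2)[OF A] by (simp add: M_def)
  hence RM: "real_mat M \<in> carrier_mat (n - 1) n" by simp
  have "det (submatrix A I ({0..<n} - {j})) \<in> minors (n - 1) M"
    using minors_row_submatrix[OF A I cI n] j(1) unfolding M_def by auto
  then obtain K J where KJ: "K \<subseteq> {0..<n - 1}" "J \<subseteq> {0..<n}" "card J = n - 1"
    and d: "det (submatrix A I ({0..<n} - {j})) = det (submatrix M K J)"
    using M unfolding minors_def by auto
  have "det (submatrix M K J) \<noteq> 0" using j A unfolding d[symmetric] by (auto simp: signed_minors_def)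
  hence "det (submatrix (real_mat M) K J) \<noteq> 0" by (simp add: submatrix_real_mat)
  hence "card {i. i < n \<and> i \<in> J} \<le> vec_space.rank (n - 1) (real_mat M)"
    using vec_space.rank_gt_minor[OF RM] by blast
  hence ge: "n - 1 \<le> vec_space.rank (n - 1) (real_mat M)"
    using restricted_index_set[OF KJ(2)] KJ(3) by simp
  interpret vec_space "TYPE(real)" "n - 1" .
  have cV: "set (cols (real_mat M)) \<subseteq> carrier_vec (n - 1)"
    using cols_dim[of "real_mat M"] unfolding carrier_matD(1)[OF RM] .
  have "rank (real_mat M) \<le> dim"
    unfolding rank_def using subspace_dim[OF span_is_subspace[OF cV] fin_dim fin_dim_span_cols[OF RM]] .
  hence "rank (real_mat M) \<le> n - 1" by (simp only: dim_is_n)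
  thus ?thesis using ge M unfolding rank_mat_def M_def[symmetric] by auto
qed

context bimodular_rows
begin

lemma nonzero_on_some_row:
  assumes "n \<le> m" "x \<in> carrier_vec n" "x \<noteq> 0\<^sub>v n"
  shows "\<exists>q < m. row A q \<bullet> x \<noteq> 0"
proof -
  have "trivial_kernel A {0..<m}"
    using trivial_kernel_of_maximal_minor[OF A _ assms(1)] max_minor by simp
  hence "\<not> (\<forall>l \<in> {0..<m}. row A l \<bullet> x = 0)"
    using assms(2,3) unfolding trivial_kernel_def carrier_matD(2)[OF A] by blast
  thus ?thesis by auto
qed

lemma facet_vector_spans_ray:
  assumes le: "n \<le> m" and p: "facet_vector I p" "p \<in> lattice_cone A" "p \<noteq> 0\<^sub>v n"
  shows "{x \<in> cone_of A. \<forall>i \<in> I. row (real_mat A) i \<bullet> x = 0} = {t \<cdot>\<^sub>v real_vec p | t. 0 \<le> t}"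
proof -
  note P = facet_vectorD[OF p(1)]
  have RA: "real_mat A \<in> carrier_mat m n" using A by simp
  have rc: "row (real_mat A) l \<in> carrier_vec n" if "l < m" for l using A that by auto
  have rp: "row (real_mat A) l \<bullet> real_vec p = real_of_int (row A l \<bullet> p)" if "l < m" for l
    by (rule row_real_vec[OF A that P(3)])
  have ppos: "0 \<le> row A l \<bullet> p" if "l < m" for l using p(2) A that by (auto simp: lattice_cone_def)
  obtain q where q: "q < m" "row A q \<bullet> p \<noteq> 0"
    using nonzero_on_some_row[OF le P(3) p(3)] by blast
  have qpos: "0 < row A q \<bullet> p" using q ppos[of q] by simp
  show ?thesis
  proof (intro equalityI subsetI)
    fix x assume "x \<in> {x \<in> cone_of A. \<forall>i \<in> I. row (real_mat A) i \<bullet> x = 0}"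
    hence x: "x \<in> carrier_vec n" "\<And>l. l < m \<Longrightarrow> 0 \<le> row (real_mat A) l \<bullet> x"
      and ker: "\<forall>i \<in> I. row (real_mat A) i \<bullet> x = 0"
      using cone_of_iff[OF A] by auto
    define b where "b = row (real_mat A) q"
    have b: "b \<in> carrier_vec n" using rc[OF q(1)] by (simp add: b_def)
    define t where "t = (b \<bullet> x) / (b \<bullet> real_vec p)"
    have bp: "0 < b \<bullet> real_vec p" using rp[OF q(1)] qpos by (simp add: b_def)
    have "x = t \<cdot>\<^sub>v real_vec p"
    proof (rule eq_vecI)
      fix j assume "j < dim_vec (t \<cdot>\<^sub>v real_vec p)"
      hence j: "j < n" using P(3) by simp
      define s where "s = signed_minors (real_mat A) I"
      have det: "det (bordered (real_mat A) I b) = (- 1) ^ n * (b \<bullet> s)"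
        unfolding s_def by (rule det_bordered[OF RA P(1,2) n b])
      have "det (bordered (real_mat A) I b) * x $ j = (- 1) ^ n * (b \<bullet> x) * s $ j"
        unfolding s_def using ker by (intro cramer_bordered[OF RA P(1,2) n b x(1) _ j]) blast
      hence e: "(b \<bullet> s) * x $ j = (b \<bullet> x) * s $ j" unfolding det by simp
      have sc: "s \<in> carrier_vec n" unfolding s_def by (rule signed_minors_carrier[OF RA])
      have "real_vec p = s \<or> real_vec p = - s"
        using p(1) unfolding facet_vector_def s_def signed_minors_real_mat by auto
      hence "(b \<bullet> real_vec p) * x $ j = (b \<bullet> x) * real_vec p $ j"
      proof
        assume m: "real_vec p = - s"
        have "b \<bullet> - s = - (b \<bullet> s)" using b sc by (intro scalar_prod_uminus_right) simp
        thus ?thesis using e j carrier_vecD[OF sc] unfolding m by simp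
      qed (use e in simp)
      thus "x $ j = (t \<cdot>\<^sub>v real_vec p) $ j"
        using bp j P(3) by (simp add: t_def field_simps)
    qed (use x P(3) in auto)
    moreover have "0 \<le> t" using x(2)[OF q(1)] bp by (simp add: t_def b_def)
    ultimately show "x \<in> {t \<cdot>\<^sub>v real_vec p | t. 0 \<le> t}" by blast
  next
    fix x assume "x \<in> {t \<cdot>\<^sub>v real_vec p | t. 0 \<le> t}"
    then obtain t where t: "x = t \<cdot>\<^sub>v real_vec p" "0 \<le> t" by blast
    have rx: "row (real_mat A) l \<bullet> x = t * real_of_int (row A l \<bullet> p)" if "l < m" for l
      using rp[OF that] rc[OF that] P(3) by (simp add: t(1))
    have "x \<in> cone_of A" using rx t P(3) ppos by (simp add: cone_of_iff[OF A])
    moreover have "\<forall>i \<in> I. row (real_mat A) i \<bullet> x = 0" using rx P(1,4) by auto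
    ultimately show "x \<in> {x \<in> cone_of A. \<forall>i \<in> I. row (real_mat A) i \<bullet> x = 0}" by blast
  qed
qed

text \<open>The face is cut out by the sum of the rows in \<open>I\<close>: on the cone this sum of nonnegative terms
  vanishes only if every term does.\<close>

lemma facet_vector_extreme_ray:
  assumes le: "n \<le> m" and p: "facet_vector I p" "p \<in> lattice_cone A" "p \<noteq> 0\<^sub>v n"
  shows "{t \<cdot>\<^sub>v real_vec p | t. 0 \<le> t} \<in> extreme_rays A"
proof -
  note P = facet_vectorD[OF p(1)]
  have finI: "finite I" using P(1) finite_subset by blast
  define c where "c = vec n (\<lambda>j. \<Sum>i\<in>I. real_mat A $$ (i, j))"
  have cx: "c \<bullet> x = (\<Sum>i\<in>I. row (real_mat A) i \<bullet> x)" if x: "x \<in> carrier_vec n" for x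
  proof -
    have "c \<bullet> x = (\<Sum>j\<in>{0..<n}. \<Sum>i\<in>I. real_mat A $$ (i, j) * x $ j)"
      using x by (simp add: c_def scalar_prod_def sum_distrib_right)
    also have "\<dots> = (\<Sum>i\<in>I. \<Sum>j\<in>{0..<n}. real_mat A $$ (i, j) * x $ j)" by (rule sum.swap)
    also have "\<dots> = (\<Sum>i\<in>I. row (real_mat A) i \<bullet> x)"
    proof (intro sum.cong refl)
      fix i assume "i \<in> I"
      hence "i < m" using P(1) by auto
      thus "(\<Sum>j\<in>{0..<n}. real_mat A $$ (i, j) * x $ j) = row (real_mat A) i \<bullet> x"
        using A x by (simp add: scalar_prod_def)
    qed
    finally show ?thesis .
  qed
  have pos: "0 \<le> row (real_mat A) i \<bullet> x" if "i \<in> I" "x \<in> cone_of A" for i x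
    using that P(1) cone_of_iff[OF A] by auto
  have xc: "x \<in> carrier_vec n" if "x \<in> cone_of A" for x using that cone_of_iff[OF A] by blast
  have "{t \<cdot>\<^sub>v real_vec p | t. 0 \<le> t} = {x \<in> cone_of A. c \<bullet> x = 0}"
    unfolding facet_vector_spans_ray[OF assms, symmetric]
    using cx[OF xc] pos finI by (auto simp: sum_nonneg_eq_0_iff)
  moreover have "\<forall>x \<in> cone_of A. 0 \<le> c \<bullet> x"
    using cx[OF xc] pos by (auto intro: sum_nonneg)
  moreover have "c \<in> carrier_vec n" by (simp add: c_def)
  ultimately have "is_face n {t \<cdot>\<^sub>v real_vec p | t. 0 \<le> t} (cone_of A)"
    unfolding is_face_def by blast
  moreover have "real_vec p \<noteq> 0\<^sub>v n"
  proof
    assume z: "real_vec p = 0\<^sub>v n"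
    have "p = 0\<^sub>v n"
    proof (rule eq_vecI)
      show "p $ j = 0\<^sub>v n $ j" if "j < dim_vec (0\<^sub>v n)" for j
        using arg_cong[OF z, of "\<lambda>v. v $ j"] that P(3) by simp
    qed (use P(3) in simp)
    thus False using p(3) by simp
  qed
  hence "set_dim n {t \<cdot>\<^sub>v real_vec p | t. 0 \<le> t} = 1" using P(3) by (intro set_dim_ray) auto
  ultimately show ?thesis using A unfolding extreme_rays_def by auto
qed

text \<open>For \<open>D\<close> the determinant bordered with row \<open>k\<close>, Cramer's rule reads \<open>D p\<^sub>j = \<plusminus>2 s\<^sub>j\<close> with \<open>s\<close> the signed
  minors of \<open>K\<close>. Since \<open>p\<close> is primitive, \<open>2 gcd(s)\<close> divides \<open>D\<close>, and \<open>\<bar>D\<bar> \<le> 2\<close>. If \<open>D = 0\<close>, all the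
  minors vanish and their gcd is 0.\<close>

lemma row_set_gcd_le_1:
  assumes p: "p \<in> carrier_vec n" "primitive p" and k: "k < m" "row A k \<bullet> p = 2"
    and K: "K \<subseteq> {0..<m}" "card K = n - 1" "\<And>i. i \<in> K \<Longrightarrow> row A i \<bullet> p = 0"
  shows "gcd_mat (row_submatrix A K) \<le> 1"
proof -
  define g where "g = gcd_mat (row_submatrix A K)"
  define D where "D = det (bordered A K (row A k))"
  have g: "g = Gcd {signed_minors A K $ j | j. j < n}"
    unfolding g_def by (rule gcd_row_submatrix[OF A K(1,2) n])
  have rk: "row A k \<in> carrier_vec n" using A k by auto
  have cr: "D * p $ j = (- 1) ^ n * (2 * signed_minors A K $ j)" if "j < n" for j
    unfolding D_def using K(3) cramer_bordered[OF A K(1,2) n rk p(1) _ that] k(2) by simp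
  have div: "2 * g dvd D * p $ j" if j: "j < dim_vec p" for j
  proof -
    have "g dvd signed_minors A K $ j" unfolding g using j p(1) by (intro Gcd_dvd) auto
    thus ?thesis using cr[of j] j p(1) by simp
  qed
  have gD: "2 * g dvd D" by (rule primitive_dvd[OF p(2) div])
  have "\<bar>D\<bar> \<le> 2" unfolding D_def using det_bordered_le[OF A K(1,2) k(1)] max_minor by simp
  show ?thesis
  proof (cases "D = 0")
    case True
    hence "signed_minors A K $ j = 0" if "j < n" for j using cr[OF that] by simp
    hence "{signed_minors A K $ j | j. j < n} \<subseteq> {0}" by auto
    hence "g = 0" unfolding g by (simp only: Gcd_0_iff)
    thus ?thesis by (simp add: g_def)
  next
    case False
    hence "\<bar>2 * g\<bar> \<le> \<bar>D\<bar>" using gD by (intro dvd_imp_le_int)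
    thus ?thesis using \<open>\<bar>D\<bar> \<le> 2\<close> by (simp add: g_def)
  qed
qed

text \<open>The rows in \<open>I\<close> attain the maximal gcd of the ray: that gcd is positive because \<open>p\<close> is nonzero, and
  no admissible row set has a gcd above 1.\<close>

lemma primitive_facet_vector_is_normalized_generator:
  assumes le: "n \<le> m" and p: "facet_vector I p" "p \<in> lattice_cone A" "primitive p"
    and k: "k < m" "row A k \<bullet> p = 2"
  shows "real_vec p \<in> normalized_generators A"
proof -
  note P = facet_vectorD[OF p(1)]
  have p0: "p \<noteq> 0\<^sub>v n" using k A by auto
  define F where "F = {t \<cdot>\<^sub>v real_vec p | t. 0 \<le> t}"
  have F: "F \<in> extreme_rays A" unfolding F_def by (rule facet_vector_extreme_ray[OF le p(1,2) p0])
  have "real_vec p = 1 \<cdot>\<^sub>v real_vec p" by simp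
  hence pF: "real_vec p \<in> F" unfolding F_def by (blast intro: zero_le_one)
  have row_sub: "row (real_mat (row_submatrix A K)) i = row (real_mat A) (pick K i)"
    if K: "K \<subseteq> {0..<m}" "card K = n - 1" "i < n - 1" for K i
  proof (rule eq_vecI)
    note c = submatrix_of_subsets(1)[OF A K(1) subset_refl] carrier_matD(2)[OF A]
    show "dim_vec (row (real_mat (row_submatrix A K)) i) = dim_vec (row (real_mat A) (pick K i))"
      using A c by simp
    fix j assume "j < dim_vec (row (real_mat A) (pick K i))"
    hence j: "j < n" using A by simp
    have "row_submatrix A K $$ (i, j) = A $$ (pick K i, pick {0..<n} j)"
      unfolding c(2) by (rule submatrix_of_subsets(2)[OF A K(1) subset_refl]) (use K j in auto)
    thus "row (real_mat (row_submatrix A K)) i $ j = row (real_mat A) (pick K i) $ j"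
      using A c K(2,3) j pick_in_index_set(2)[OF K(1), of i] by (simp add: pick_initial_segment)
  qed
  have dims: "real_mat (row_submatrix A K) \<in> carrier_mat (n - 1) n"
    if K: "K \<subseteq> {0..<m}" "card K = n - 1" for K
    using submatrix_of_subsets(1)[OF A K(1) subset_refl] K(2) carrier_matD(2)[OF A] by simp
  have rp: "row (real_mat A) l \<bullet> real_vec p = real_of_int (row A l \<bullet> p)" if "l < m" for l
    by (rule row_real_vec[OF A that P(3)])
  obtain j where j: "j < n" "p $ j \<noteq> 0" using p0 P(3) by (metis carrier_vecD eq_vecI index_zero_vec)
  hence sj: "signed_minors A I $ j \<noteq> 0" using P(7)[OF j(1)] by auto
  have IF: "I \<in> ray_row_sets A F"
  proof -
    have "real_mat (row_submatrix A I) *\<^sub>v r = 0\<^sub>v (n - 1)" if rF: "r \<in> F" for r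
    proof (rule eq_vecI)
      fix i assume "i < dim_vec (0\<^sub>v (n - 1))"
      hence i: "i < n - 1" by simp
      obtain t where t: "r = t \<cdot>\<^sub>v real_vec p" using rF by (auto simp: F_def)
      have pk: "pick I i < m" "pick I i \<in> I" using pick_in_index_set[OF P(1), of i] i P(2) by auto
      have "row (real_mat A) (pick I i) \<in> carrier_vec n" using A pk by auto
      hence "row (real_mat A) (pick I i) \<bullet> r = 0"
        using rp[OF pk(1)] P(4)[OF pk(2)] P(3) by (simp add: t)
      thus "(real_mat (row_submatrix A I) *\<^sub>v r) $ i = 0\<^sub>v (n - 1) $ i"
        using dims[OF P(1,2)] row_sub[OF P(1,2) i] i by simp
    qed (use dims[OF P(1,2)] in auto)
    thus ?thesis using A P(1,2) rank_row_submatrix[OF A P(1,2) j(1) sj] unfolding ray_row_sets_def by auto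
  qed
  have "1 \<le> gcd_mat (row_submatrix A I)"
  proof -
    have "gcd_mat (row_submatrix A I) \<noteq> 0"
      unfolding gcd_row_submatrix[OF A P(1,2) n] using j(1) sj by (auto simp: Gcd_0_iff)
    moreover have "0 \<le> gcd_mat (row_submatrix A I)" unfolding gcd_mat_def by simp
    ultimately show ?thesis by linarith
  qed
  moreover have "gcd_mat (row_submatrix A K) \<le> 1" if K: "K \<in> ray_row_sets A F" for K
  proof (rule row_set_gcd_le_1[OF P(3) p(3) k])
    show Km: "K \<subseteq> {0..<m}" "card K = n - 1" using K A by (auto simp: ray_row_sets_def)
    fix i assume iK: "i \<in> K"
    then obtain c where c: "c < n - 1" "pick K c = i" using index_is_pick[OF Km(1)] Km(2) by metis
    have "real_mat (row_submatrix A K) *\<^sub>v real_vec p = 0\<^sub>v (n - 1)"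
      using K pF A unfolding ray_row_sets_def by auto
    hence "(real_mat (row_submatrix A K) *\<^sub>v real_vec p) $ c = 0" using c(1) by simp
    moreover have "(real_mat (row_submatrix A K) *\<^sub>v real_vec p) $ c = row (real_mat A) i \<bullet> real_vec p"
      using dims[OF Km] row_sub[OF Km c(1)] c by simp
    ultimately show "row A i \<bullet> p = 0" using rp[of i] iK Km(1) by auto
  qed
  ultimately have "\<forall>K \<in> ray_row_sets A F. gcd_mat (row_submatrix A K) \<le> gcd_mat (row_submatrix A I)"
    by force
  moreover have "real_vec p = minor_vec A I \<or> real_vec p = - minor_vec A I"
    using p(1) unfolding facet_vector_def minor_vec_eq by auto
  ultimately show ?thesis using F IF pF unfolding normalized_generators_def by blast
qed

end

text \<open>Nontriviality keeps \<open>h\<close> off the lines through signed minor vectors of the cone: if such a vector were a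
  multiple of the integer point \<open>y\<close> underlying \<open>h\<close>, then \<open>h\<close> would lie on its extreme ray.\<close>

theorem theorem1p5:
  fixes A :: "int mat" and m n :: nat and h :: "real vec"
  assumes "A \<in> carrier_mat m n"
    and "bimodular A"
    and "h \<in> nontrivial_hilbert_basis A"
  shows "\<exists>r \<in> normalized_generators A. \<exists>s \<in> normalized_generators A.
    r \<noteq> s \<and> h = (1/2) \<cdot>\<^sub>v r + (1/2) \<cdot>\<^sub>v s"
proof -
  note A = assms(1)
  have hil: "h \<in> cone_of A" "h \<in> int_points n" "h \<noteq> 0\<^sub>v n"
    and irred: "\<And>z1 z2. z1 \<in> cone_of A \<Longrightarrow> z1 \<in> int_points n \<Longrightarrow> z2 \<in> cone_of A \<Longrightarrow>
      z2 \<in> int_points n \<Longrightarrow> h = z1 + z2 \<Longrightarrow> z1 = 0\<^sub>v n \<or> z2 = 0\<^sub>v n"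
    and nontriv: "\<And>F. F \<in> extreme_rays A \<Longrightarrow> h \<notin> F"
    using assms(3) unfolding nontrivial_hilbert_basis_def hilbert_basis_def carrier_matD(2)[OF A]
    by blast+
  obtain y where y: "y \<in> carrier_vec n" "h = real_vec y"
    using hil(2) unfolding int_points_are_integer_vectors by blast
  have y0: "y \<noteq> 0\<^sub>v n"
  proof
    assume "y = 0\<^sub>v n"
    hence "real_vec y = 0\<^sub>v n" by (intro eq_vecI) simp_all
    hence "h = 0\<^sub>v n" using y(2) by simp
    thus False using hil(3) by simp
  qed
  have n: "0 < n" using y(1) y0 by (cases n) auto
  have bim: "n \<le> m" "max_minor A = 2" using assms(1,2) by (simp_all add: bimodular_def)
  interpret bimodular_rows A m n using A bim n by unfold_locales
  have yL: "y \<in> lattice_cone A" using hil(1) unfolding y(2) real_vec_in_cone_iff[OF A y(1)] .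
  have indec: "indecomposable A y" unfolding indecomposable_def
  proof (intro conjI ballI impI yL)
    fix z1 z2 assume z: "z1 \<in> lattice_cone A" "z2 \<in> lattice_cone A" "y = z1 + z2"
    have c: "z1 \<in> carrier_vec n" "z2 \<in> carrier_vec n" using z A by (auto simp: lattice_cone_def)
    have "h = real_vec z1 + real_vec z2" unfolding y(2) z(3) using c by (intro eq_vecI) auto
    moreover have "real_vec z1 \<in> cone_of A" "real_vec z2 \<in> cone_of A"
      using z(1,2) by (simp_all only: real_vec_in_cone_iff[OF A c(1)] real_vec_in_cone_iff[OF A c(2)])
    moreover have "real_vec z1 \<in> int_points n" "real_vec z2 \<in> int_points n"
      unfolding int_points_are_integer_vectors using c by blast+
    ultimately have "real_vec z1 = 0\<^sub>v n \<or> real_vec z2 = 0\<^sub>v n" by (intro irred)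
    moreover have "x = 0\<^sub>v n" if x: "real_vec x = 0\<^sub>v n" "x \<in> carrier_vec n" for x
    proof (rule eq_vecI)
      show "x $ j = 0\<^sub>v n $ j" if "j < dim_vec (0\<^sub>v n)" for j
        using arg_cong[OF x(1), of "\<lambda>v. v $ j"] that x(2) by simp
    qed (use x in simp)
    ultimately show "z1 = 0\<^sub>v (dim_col A) \<or> z2 = 0\<^sub>v (dim_col A)"
      unfolding carrier_matD(2)[OF A] using c by blast
  qed
  have off: "p \<noteq> g \<cdot>\<^sub>v y"
    if p: "facet_vector I p" "p \<in> lattice_cone A" "p \<noteq> 0\<^sub>v n" for I p g
  proof
    assume eq: "p = g \<cdot>\<^sub>v y"
    obtain q where q: "q < m" "row A q \<bullet> p \<noteq> 0"
      using nonzero_on_some_row[OF bim(1) facet_vectorD(3)[OF p(1)] p(3)] by blast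
    have "row A q \<in> carrier_vec n" using A q by auto
    hence "row A q \<bullet> p = g * (row A q \<bullet> y)" using y(1) by (simp add: eq)
    moreover have "0 \<le> row A q \<bullet> p" "0 \<le> row A q \<bullet> y"
      using p(2) yL A q by (auto simp: lattice_cone_def)
    ultimately have g: "0 < g" using q(2) by (smt (verit) mult_nonpos_nonneg)
    have "h = (1 / real_of_int g) \<cdot>\<^sub>v real_vec p"
      unfolding y(2) eq using y(1) g by (intro eq_vecI) auto
    moreover have "0 \<le> 1 / real_of_int g" using g by simp
    ultimately have "h \<in> {t \<cdot>\<^sub>v real_vec p | t. 0 \<le> t}" by blast
    thus False using nontriv[OF facet_vector_extreme_ray[OF bim(1) p]] by blast
  qed
  obtain I p J w where pw: "facet_vector I p" "facet_vector J w" "p \<in> lattice_cone A"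
    "w \<in> lattice_cone A" "primitive p" "primitive w" "\<exists>k < m. row A k \<bullet> p = 2" "\<exists>k < m. row A k \<bullet> w = 2"
    "p \<noteq> w" and w: "w = 2 \<cdot>\<^sub>v y - p"
    using indecomposable_is_half_sum[OF bim(1) indec y0] off by blast
  have pc: "p \<in> carrier_vec n" by (rule facet_vectorD(3)[OF pw(1)])
  have wc: "w \<in> carrier_vec n" by (rule facet_vectorD(3)[OF pw(2)])
  have "real_vec p \<in> normalized_generators A" "real_vec w \<in> normalized_generators A"
    using primitive_facet_vector_is_normalized_generator[OF bim(1)] pw by blast+
  moreover have "real_vec p \<noteq> real_vec w"
  proof
    assume eq: "real_vec p = real_vec w"
    have "p = w"
    proof (rule eq_vecI)
      show "p $ j = w $ j" if "j < dim_vec w" for j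
        using arg_cong[OF eq, of "\<lambda>v. v $ j"] that pc wc by simp
    qed (use pc wc in simp)
    thus False using pw(9) by simp
  qed
  moreover have "h = (1/2) \<cdot>\<^sub>v real_vec p + (1/2) \<cdot>\<^sub>v real_vec w"
    unfolding y(2) w using y(1) pc by (intro eq_vecI) (auto simp: field_simps)
  ultimately show ?thesis by blast
qed

end
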